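(* Let $K$ be a totally real number field of degree $d$ over $\mathbb{Q}$ with ring of integers $\mathcal{O}_K$ and discriminant $\Delta_K$. Let $n>d$ be an integer and let $\boldsymbol\alpha=(\alpha_1,\dots,\alpha_n)$ be an $n$-tuple of nonzero elements of $\mathcal{O}_K^+$ such that $\mathcal{O}_K=\operatorname{span}_{\mathbb{Z}}\{\alpha_1,\dots,\alpha_n\}$. Let $T_1,T_2\in\mathbb{R}_{\ge0}$ with $T_1<T_2$. Then $$\sum_{\beta\in\operatorname{Sg}_1(\boldsymbol\alpha,T_1,T_2)}r(\beta)\le\left(\frac{d!\,H_K(\boldsymbol\alpha)}{|\Delta_K|^{1/2}}T_2+1\right)^n-\left[\frac{T_1^{1/d}}{n\,H_K(\boldsymbol\alpha)^{1/d}}\right]^n.$$ In particular, for every integer $s\ge1$, $$|\operatorname{Sg}_s(\boldsymbol\alpha,T_1,T_2)|\le\frac1s\left\{\left(\frac{d!\,H_K(\boldsymbol\alpha)}{|\Delta_K|^{1/2}}T_2+1\right)^n-\left[\frac{T_1^{1/d}}{n\,H_K(\boldsymbol\alpha)^{1/d}}\right]^n\right\}.$$ On the other hand, for every real $T\ge1$, $$\sum_{\beta\in\operatorname{Sg}_1(\boldsymbol\alpha,1,T)}r(\beta)\ge\left[\frac{T^{1/d}}{n\,H_K(\boldsymbol\alpha)^{1/d}}\right]^n.$$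
   Context: Let $\sigma_1,\dots,\sigma_d:K\to\mathbb{R}$ be the embeddings of $K$. Put $\mathcal{O}_K^+=\{\alpha\in\mathcal{O}_K:\sigma_i(\alpha)\ge 0 \text{ for all } 1\le i\le d\}$ and $\operatorname{Sg}(\boldsymbol\alpha)=\{\sum_{i=1}^n\alpha_ix_i:\boldsymbol x\in\mathbb{Z}_{\ge 0}^n\}$. For an integer $s\ge1$, $\operatorname{Sg}_s(\boldsymbol\alpha)$ is the set of all $\beta\in\operatorname{Sg}(\boldsymbol\alpha)$ for which there are at least $s$ distinct $\boldsymbol x\in\mathbb{Z}_{\ge0}^n$ with $\sum_{i=1}^n\alpha_ix_i=\beta$; thus $\operatorname{Sg}_1(\boldsymbol\alpha)=\operatorname{Sg}(\boldsymbol\alpha)$. For real numbers $0\le T_1\le T_2$, $$\operatorname{Sg}_s(\boldsymbol\alpha,T_1,T_2)=\{\beta\in\operatorname{Sg}_s(\boldsymbol\alpha):T_1\le H_K(\beta)\le T_2\}.$$ For $\beta\in\operatorname{Sg}(\boldsymbol\alpha)$, $r(\beta)=\max\{s:\beta\in\operatorname{Sg}_s(\boldsymbol\alpha)\}$. The symbol $[\ ]$ denotes the integer part. Let $M(K)$ be the set of places of $K$ and $d_v=[K_v:\mathbb{Q}_v]$ the local degree at $v$. Absolute values are normalized so that the product formula reads $\prod_{v\in M(K)}|a|_v=1$ for all nonzero $a\in K$, i.e. $|\cdot|_v$ is the $d_v$-th power of the absolute value extending the usual (real or $p$-adic) one on $\mathbb{Q}$. For $\boldsymbol\gamma=(\gamma_1,\dots,\gamma_m)\in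 K^m$ (in particular for a single element, $m=1$) the inhomogeneous height is $$H_K(\boldsymbol\gamma)=\prod_{v\in M(K)}\max\{1,|\gamma_1|_v,\dots,|\gamma_m|_v\}.$$ *)

theory Defs
  imports Complex_Main "HOL-Algebra.QuotRing" "HOL-Algebra.Embedded_Algebras"
    "Jordan_Normal_Form.Determinant"
begin

text \<open>
  A number field is a type \<open>'k\<close> of class \<^class>\<open>field_char_0\<close> that is finite-dimensional over
  the rationals.  Field embeddings are the type-class homomorphisms \<^const>\<open>field_hom\<close>.
\<close>

subsection \<open>Number fields\<close>

abbreviation rat_scale :: "rat \<Rightarrow> 'k::field_char_0 \<Rightarrow> 'k" where
  "rat_scale q x \<equiv> of_rat q * x"

abbreviation int_scale :: "int \<Rightarrow> 'k::field_char_0 \<Rightarrow> 'k" where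
  "int_scale m x \<equiv> of_int m * x"

definition number_field :: "'k::field_char_0 itself \<Rightarrow> bool" where
  "number_field _ \<longleftrightarrow> (\<exists>B :: 'k set. finite B \<and> module.span rat_scale B = UNIV)"

definition field_degree :: "'k::field_char_0 itself \<Rightarrow> nat" where
  "field_degree _ = vector_space.dim rat_scale (UNIV :: 'k set)"

definition totally_real :: "'k::field_char_0 itself \<Rightarrow> bool" where
  "totally_real _ \<longleftrightarrow> (\<forall>\<sigma> :: 'k \<Rightarrow> complex. field_hom \<sigma> \<longrightarrow> range \<sigma> \<subseteq> \<real>)"

definition ring_of_integers :: "'k::field_char_0 set" where
  "ring_of_integers = {x. algebraic_int x}"

definition nonneg_integers :: "'k::field_char_0 set" where
  "nonneg_integers =
     {x \<in> ring_of_integers. \<forall>\<sigma> :: 'k \<Rightarrow> real. field_hom \<sigma> \<longrightarrow> \<sigma> x \<ge> 0}"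

definition integral_basis :: "'k::field_char_0 list \<Rightarrow> bool" where
  "integral_basis \<omega> \<longleftrightarrow>
     bij_betw (\<lambda>c :: int list. \<Sum>i<length \<omega>. of_int (c ! i) * \<omega> ! i)
       {c. length c = length \<omega>} ring_of_integers"

definition embedding_list :: "('k::field_char_0 \<Rightarrow> complex) list \<Rightarrow> bool" where
  "embedding_list \<sigma> \<longleftrightarrow> distinct \<sigma> \<and> set \<sigma> = {\<tau>. field_hom \<tau>}"

text \<open>
  The discriminant \<open>det (\<sigma>\<^sub>i \<omega>\<^sub>j)\<^sup>2\<close>, a rational integer, is kept as a complex number.  It does not
  depend on which integral basis and which enumeration of the embeddings is chosen.
\<close>

definition discriminant :: "'k::field_char_0 itself \<Rightarrow> complex" where
  "discriminant K =
     (let d = field_degree K;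
          \<omega> = (SOME \<omega> :: 'k list. integral_basis \<omega>);
          \<sigma> = (SOME \<sigma> :: ('k \<Rightarrow> complex) list. embedding_list \<sigma>)
      in (det (mat d d (\<lambda>(i, j). (\<sigma> ! i) (\<omega> ! j))))\<^sup>2)"

subsection \<open>Places and completions\<close>

definition absolute_value :: "('k::field_char_0 \<Rightarrow> real) \<Rightarrow> bool" where
  "absolute_value v \<longleftrightarrow>
     (\<forall>x. v x \<ge> 0) \<and> (\<forall>x. v x = 0 \<longleftrightarrow> x = 0) \<and>
     (\<forall>x y. v (x * y) = v x * v y) \<and> (\<forall>x y. v (x + y) \<le> v x + v y)"

definition padic_abs :: "nat \<Rightarrow> rat \<Rightarrow> real" where
  "padic_abs p q =
     (if q = 0 then 0
      else real p powi (int (multiplicity (int p) (snd (quotient_of q)))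
                        - int (multiplicity (int p) (fst (quotient_of q)))))"

text \<open>
  By Ostrowski's theorem every place, i.e. every class of equivalent nontrivial absolute values of
  a number field, contains exactly one member that extends the usual or a \<open>p\<close>-adic absolute value
  of the rationals.  Places are represented by this member.
\<close>

definition places :: "('k::field_char_0 \<Rightarrow> real) set" where
  "places = {v. absolute_value v \<and>
     ((\<forall>q. v (of_rat q) = \<bar>of_rat q\<bar>) \<or>
      (\<exists>p. prime p \<and> (\<forall>q. v (of_rat q) = padic_abs p q)))}"

definition cauchy_seqs :: "('k::field_char_0 \<Rightarrow> real) \<Rightarrow> (nat \<Rightarrow> 'k) set" where
  "cauchy_seqs v = {X. \<forall>e>0. \<exists>N. \<forall>m\<ge>N. \<forall>n\<ge>N. v (X m - X n) < e}"

definition null_seqs :: "('k::field_char_0 \<Rightarrow> real) \<Rightarrow> (nat \<Rightarrow> 'k) set" where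
  "null_seqs v = {X. (\<lambda>n. v (X n)) \<longlonglongrightarrow> 0}"

definition cauchy_ring :: "('k::field_char_0 \<Rightarrow> real) \<Rightarrow> (nat \<Rightarrow> 'k) ring" where
  "cauchy_ring v =
     \<lparr>carrier = cauchy_seqs v, monoid.mult = (\<lambda>X Y n. X n * Y n), one = (\<lambda>n. 1),
      zero = (\<lambda>n. 0), add = (\<lambda>X Y n. X n + Y n)\<rparr>"

definition completion :: "('k::field_char_0 \<Rightarrow> real) \<Rightarrow> (nat \<Rightarrow> 'k) set ring" where
  "completion v = cauchy_ring v Quot null_seqs v"

text \<open>
  The completion of the rationals at the place below \<open>v\<close>, as the subfield of the completion at
  \<open>v\<close> consisting of the classes of rational Cauchy sequences.
\<close>

definition rat_completion :: "('k::field_char_0 \<Rightarrow> real) \<Rightarrow> (nat \<Rightarrow> 'k) set set" where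
  "rat_completion v =
     (\<lambda>X. null_seqs v +>\<^bsub>cauchy_ring v\<^esub> X) ` {X \<in> cauchy_seqs v. range X \<subseteq> \<rat>}"

definition local_degree :: "('k::field_char_0 \<Rightarrow> real) \<Rightarrow> nat" where
  "local_degree v =
     (THE m. ring.dimension (completion v) m (rat_completion v) (carrier (completion v)))"

subsection \<open>The height\<close>

definition local_height :: "('k::field_char_0 \<Rightarrow> real) \<Rightarrow> 'k list \<Rightarrow> real" where
  "local_height v \<gamma> = Max (insert 1 ((\<lambda>x. v x ^ local_degree v) ` set \<gamma>))"

text \<open>
  Only finitely many factors of the product over all places differ from 1; the product is taken
  over those.  The height of a single element \<open>x\<close> is \<open>height [x]\<close>.
\<close>

definition height :: "'k::field_char_0 list \<Rightarrow> real" where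
  "height \<gamma> = (\<Prod>v\<in>{v \<in> places. local_height v \<gamma> \<noteq> 1}. local_height v \<gamma>)"

subsection \<open>Semigroups\<close>

definition representations :: "'k::field_char_0 list \<Rightarrow> 'k \<Rightarrow> nat list set" where
  "representations \<alpha> \<beta> =
     {x. length x = length \<alpha> \<and> (\<Sum>i<length \<alpha>. \<alpha> ! i * of_nat (x ! i)) = \<beta>}"

definition Sg :: "'k::field_char_0 list \<Rightarrow> 'k set" where
  "Sg \<alpha> = {\<Sum>i<length \<alpha>. \<alpha> ! i * of_nat (x ! i) | x :: nat list. length x = length \<alpha>}"

definition Sg_s :: "nat \<Rightarrow> 'k::field_char_0 list \<Rightarrow> 'k set" where
  "Sg_s s \<alpha> = {\<beta> \<in> Sg \<alpha>. \<exists>X \<subseteq> representations \<alpha> \<beta>. finite X \<and> card X = s}"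

definition Sg_bounded :: "nat \<Rightarrow> 'k::field_char_0 list \<Rightarrow> real \<Rightarrow> real \<Rightarrow> 'k set" where
  "Sg_bounded s \<alpha> T1 T2 = {\<beta> \<in> Sg_s s \<alpha>. T1 \<le> height [\<beta>] \<and> height [\<beta>] \<le> T2}"

definition rep_count :: "'k::field_char_0 list \<Rightarrow> 'k \<Rightarrow> nat" where
  "rep_count \<alpha> \<beta> = Max {s. 1 \<le> s \<and> \<beta> \<in> Sg_s s \<alpha>}"

end

theory Submission
  imports Defs "HOL-Library.Function_Algebras" "HOL-Computational_Algebra.Field_as_Ring"
    "HOL-Computational_Algebra.Fundamental_Theorem_Algebra" "Jordan_Normal_Form.Char_Poly"
begin

text \<open>
  Counting the elements \<open>\<beta>\<close> of the semigroup with multiplicity \<open>r(\<beta>)\<close> is counting the vectors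
  \<open>x\<close> of natural numbers with \<open>\<beta> = \<Sum>\<alpha>\<^sub>i x\<^sub>i\<close>, so both bounds compare the set of \<open>x\<close> with
  \<open>T\<^sub>1 \<le> H(\<beta>) \<le> T\<^sub>2\<close> with cubes.  For algebraic integers of a totally real field the
  height is a product over the \<open>d\<close> real embeddings, \<open>H(\<beta>) = \<Prod>\<^sub>\<tau> max 1 \<tau>(\<beta>)\<close>
  (\<open>height_totally_real_integers\<close>), and from this formula come both comparisons.

  \<^item> If \<open>\<beta> = \<Sum>\<alpha>\<^sub>i x\<^sub>i\<close> then \<open>\<tau>(\<alpha>\<^sub>i) x\<^sub>i \<le> \<tau>(\<beta>)\<close> for every \<open>\<tau>\<close>.  Multiplying over \<open>\<tau>\<close>
    and using that the norm of \<open>\<alpha>\<^sub>i\<close> is at least 1 gives \<open>x\<^sub>i \<le> x\<^sub>i\<^sup>d \<le> H(\<beta>)\<close>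
    (\<open>entry_le_height\<close>).  So all the \<open>x\<close> lie in a cube of side \<open>T\<^sub>2\<close>, and the
    factor \<open>d! H(\<alpha>) / \<surd>\<bar>\<Delta>\<bar>\<close> of the theorem only enlarges it: it is at least 1, because the
    \<open>\<alpha>\<^sub>i\<close> contain a basis of the field, whose embedding determinant is a nonzero integer multiple of
    \<open>\<surd>\<bar>\<Delta>\<bar>\<close> and is at most \<open>d! H(\<alpha>)\<close> by the Leibniz formula (\<open>discriminant_bound\<close>).

  \<^item> Conversely \<open>\<tau>(\<beta>) \<le> n M\<^sub>\<tau> max\<^sub>i x\<^sub>i\<close> where \<open>M\<^sub>\<tau> = max 1 (max\<^sub>i \<tau>(\<alpha>\<^sub>i))\<close> and \<open>H(\<alpha>) = \<Prod>\<^sub>\<tau> M\<^sub>\<tau>\<close>.  Hence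
    all \<open>x\<close> with entries below \<open>N = [T\<^sup>1\<^sup>/\<^sup>d / (n H(\<alpha>)\<^sup>1\<^sup>/\<^sup>d)]\<close> have \<open>H(\<beta>) < T\<close> (\<open>height_box\<close>).  There
    are \<open>N\<^sup>n\<close> of them; for \<open>T = T\<^sub>1\<close> they may be subtracted from the upper bound, and for
    \<open>T\<^sub>1 = 1\<close> they all count for the lower bound.

  Most of the work is the height formula.  It needs the \<open>d\<close> embeddings and the nonvanishing of their
  determinant: the embeddings are a basis of the space of rational-linear maps into the complex
  numbers, since this space is spanned by joint eigenvectors of the multiplication operators, and a
  joint eigenvector is a multiple of an embedding (\<open>field_homs_card\<close>).  It also
  needs that every place over the usual absolute value comes from a real embedding: such a
  place is bounded by the embeddings, so every element of the field is a limit of rational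
  numbers, and the limit, taken in the reals, is the embedding (\<open>archimedean_place_embedding\<close>).
\<close>

section \<open>Embeddings of a number field\<close>

interpretation Q: vector_space "rat_scale :: rat \<Rightarrow> 'k::field_char_0 \<Rightarrow> 'k"
  by unfold_locales (simp_all add: algebra_simps of_rat_add of_rat_mult)

definition fun_scale :: "complex \<Rightarrow> ('k \<Rightarrow> complex) \<Rightarrow> 'k \<Rightarrow> complex" where
  "fun_scale c f = (\<lambda>x. c * f x)"

interpretation F: vector_space "fun_scale :: complex \<Rightarrow> ('k \<Rightarrow> complex) \<Rightarrow> 'k \<Rightarrow> complex"
  by unfold_locales (simp_all add: fun_scale_def fun_eq_iff algebra_simps)

lemma sum_fun_apply: "(\<Sum>i\<in>I. f i) y = (\<Sum>i\<in>I. f i y)" for f :: "'i \<Rightarrow> 'a \<Rightarrow> complex"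
  by (induction I rule: infinite_finite_induct) auto

lemma number_field_basis:
  assumes "number_field TYPE('k::field_char_0)"
  obtains B :: "'k::field_char_0 set" where "finite B" "Q.independent B" "Q.span B = UNIV"
    "card B = field_degree TYPE('k)"
proof -
  obtain S :: "'k set" where S: "finite S" "Q.span S = UNIV"
    using assms unfolding number_field_def by blast
  obtain B where B: "B \<subseteq> UNIV" "Q.independent B" "(UNIV::'k set) \<subseteq> Q.span B" "card B = Q.dim (UNIV::'k set)"
    by (rule Q.basis_exists)
  have "finite B"
    using Q.independent_span_bound[OF S(1) B(2)] S(2) by simp
  with B show thesis by (intro that[of B]) (auto simp: field_degree_def)
qed

lemma algebraic_over_rat:
  fixes x :: "'k::field_char_0"
  assumes "number_field TYPE('k)"
  shows "\<exists>p :: rat poly. p \<noteq> 0 \<and> poly (map_poly of_rat p) x = 0"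
proof -
  obtain B :: "'k set" where B: "finite B" "Q.span B = UNIV"
    using assms unfolding number_field_def by blast
  define N where "N = card B"
  have eval: "poly (map_poly of_rat (\<Sum>i\<in>I. monom (f i) i)) x = (\<Sum>i\<in>I. of_rat (f i) * x ^ i)"
    if "finite I" for I and f :: "nat \<Rightarrow> rat"
  proof -
    interpret hp: map_poly_comm_ring_hom "of_rat :: rat \<Rightarrow> 'k" ..
    show ?thesis
      by (simp add: hp.hom_sum poly_sum map_poly_monom poly_monom)
  qed
  show ?thesis
  proof (cases "inj_on (\<lambda>i. x ^ i) {..N}")
    case False
    then obtain i j where ij: "i \<noteq> j" "x ^ i = x ^ j" by (auto simp: inj_on_def)
    define f where "f k = (if k = i then 1 else -1 :: rat)" for k
    have "poly (map_poly of_rat (\<Sum>k\<in>{i,j}. monom (f k) k)) x = 0"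
      using ij by (subst eval) (auto simp: f_def of_rat_minus)
    moreover have "coeff (\<Sum>k\<in>{i,j}. monom (f k) k) i = 1"
      using ij by (simp add: f_def)
    hence "(\<Sum>k\<in>{i,j}. monom (f k) k) \<noteq> 0" by (metis coeff_0 zero_neq_one)
    ultimately show ?thesis by blast
  next
    case True
    let ?S = "(\<lambda>i. x ^ i) ` {..N}"
    have "card ?S = Suc N" using True by (simp add: card_image)
    then have "\<not> Q.independent ?S"
      using Q.independent_span_bound[OF B(1), of ?S] B(2) N_def by auto
    then obtain u where u: "\<exists>v\<in>?S. u v \<noteq> 0" "(\<Sum>v\<in>?S. of_rat (u v) * v) = 0"
      using Q.dependent_finite[of ?S] by auto
    then obtain j where j: "j \<le> N" "u (x ^ j) \<noteq> 0" by auto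
    have "(\<Sum>i\<le>N. of_rat (u (x ^ i)) * x ^ i) = 0"
      using u(2) True by (simp add: sum.reindex)
    hence "poly (map_poly of_rat (\<Sum>i\<in>{..N}. monom (u (x ^ i)) i)) x = 0"
      by (subst eval) auto
    moreover have "coeff (\<Sum>i\<in>{..N}. monom (u (x ^ i)) i) j = u (x ^ j)"
      using j(1) by (simp add: coeff_sum if_distrib cong: if_cong)
    hence "(\<Sum>i\<in>{..N}. monom (u (x ^ i)) i) \<noteq> 0" using j(2) by (metis coeff_0)
    ultimately show ?thesis by blast
  qed
qed

text \<open>
  Simple complex roots are what makes multiplication by \<open>x\<close> diagonalizable on the complex-valued
  rational-linear maps.  An annihilator \<open>p\<close> of least degree has them: its gcd with \<open>p'\<close> or the cofactor
  of that gcd kills \<open>x\<close>.  The gcd has too small a degree for that, so the cofactor has full degree and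
  the gcd is constant.
\<close>

lemma separable_annihilator:
  fixes x :: "'k::field_char_0"
  assumes "number_field TYPE('k)"
  obtains p :: "rat poly" where "p \<noteq> 0" "poly (map_poly of_rat p) x = 0"
    "rsquarefree (map_poly of_rat p :: complex poly)"
proof -
  interpret hp: map_poly_comm_ring_hom "of_rat :: rat \<Rightarrow> 'k" ..
  interpret cp: map_poly_comm_ring_hom "of_rat :: rat \<Rightarrow> complex" ..
  let ?P = "\<lambda>p::rat poly. p \<noteq> 0 \<and> poly (map_poly of_rat p) x = 0"
  define p where "p = arg_min degree ?P"
  obtain p0 where "?P p0" using algebraic_over_rat[OF assms] by blast
  then have p: "?P p" and min: "\<And>q. ?P q \<Longrightarrow> degree p \<le> degree q"
    unfolding p_def using arg_min_natI[of ?P p0 degree] arg_min_nat_le[of ?P _ degree] by blast+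
  have deg: "degree p > 0"
  proof (rule ccontr)
    assume "\<not> ?thesis"
    then obtain c where "p = [:c:]" by (metis degree_eq_zeroE neq0_conv)
    with p show False by (auto simp: map_poly_pCons)
  qed
  then have dp: "pderiv p \<noteq> 0" by (metis pderiv_eq_0_iff less_irrefl)
  define q where "q = gcd p (pderiv p)"
  obtain s where s: "p = q * s" unfolding q_def by (metis gcd_dvd1 dvdE)
  have "poly (map_poly of_rat q) x * poly (map_poly of_rat s) x = 0"
    using p s by (metis hp.hom_mult poly_mult)
  moreover have "poly (map_poly of_rat q) x \<noteq> 0"
  proof
    assume "poly (map_poly of_rat q) x = 0"
    with p s have "degree p \<le> degree q" by (intro min) auto
    moreover have "q dvd pderiv p" unfolding q_def by simp
    then have "degree q \<le> degree (pderiv p)" using dp by (rule dvd_imp_degree_le)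
    ultimately show False using deg degree_pderiv[of p] by simp
  qed
  ultimately have "degree p \<le> degree s" using p s by (intro min) auto
  with p s have "degree q = 0" by (auto simp: degree_mult_eq)
  with p s have "is_unit q" by (metis is_unit_iff_degree mult_zero_left)
  then have "coprime p (pderiv p)" unfolding q_def
    by (metis is_unit_gcd)
  then obtain a b where ab: "a * p + b * pderiv p = 1"
    by (metis bezout_coefficients_fst_snd coprime_imp_gcd_eq_1)
  have "map_poly of_rat a * map_poly of_rat p + map_poly of_rat b * pderiv (map_poly of_rat p) = (1::complex poly)"
    using arg_cong[OF ab, of "map_poly (of_rat :: rat \<Rightarrow> complex)"]
    by (simp add: cp.hom_add cp.hom_mult of_rat_hom.map_poly_pderiv)
  then have "\<not> (poly (map_poly of_rat p) r = 0 \<and> poly (pderiv (map_poly of_rat p)) r = 0)" for r :: complex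
    by (metis add.right_neutral mult_zero_right poly_1 poly_add poly_mult zero_neq_one)
  then have "rsquarefree (map_poly of_rat p :: complex poly)"
    by (auto simp: rsquarefree_roots)
  with p show thesis by (intro that) auto
qed





definition rat_linear :: "('k::field_char_0 \<Rightarrow> complex) \<Rightarrow> bool" where
  "rat_linear \<phi> \<longleftrightarrow> (\<forall>x y. \<phi> (x + y) = \<phi> x + \<phi> y) \<and> (\<forall>q x. \<phi> (of_rat q * x) = of_rat q * \<phi> x)"

lemma rat_linear_sum: "rat_linear \<phi> \<Longrightarrow> \<phi> (\<Sum>i\<in>I. of_rat (q i) * f i) = (\<Sum>i\<in>I. of_rat (q i) * \<phi> (f i))"
proof -
  assume *: "rat_linear \<phi>"
  then have "\<phi> 0 = 0" unfolding rat_linear_def by (metis add_cancel_right_right)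
  with * show ?thesis
    by (induction I rule: infinite_finite_induct) (auto simp: rat_linear_def)
qed

text \<open>
  The action of \<open>P(T)\<close> on \<open>\<phi>\<close>, where \<open>T\<close> is the operator sending \<open>\<phi>\<close> to \<open>\<lambda>y. \<phi> (x * y)\<close>.
\<close>

definition poly_act :: "'k::field_char_0 \<Rightarrow> complex poly \<Rightarrow> ('k \<Rightarrow> complex) \<Rightarrow> 'k \<Rightarrow> complex" where
  "poly_act x P \<phi> y = (\<Sum>i\<le>degree P. coeff P i * \<phi> (x ^ i * y))"

lemma poly_act_upto:
  assumes "degree P \<le> N"
  shows "poly_act x P \<phi> y = (\<Sum>i\<le>N. coeff P i * \<phi> (x ^ i * y))"
  unfolding poly_act_def using assms
  by (intro sum.mono_neutral_left) (auto simp: coeff_eq_0)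

lemma poly_act_linear_factor:
  "poly_act x ([:-r, 1:] * P) \<phi> = poly_act x P (\<lambda>y. \<phi> (x * y) - r * \<phi> y)"
proof
  fix y
  define N where "N = degree P"
  have deg: "degree ([:-r, 1:] * P) \<le> Suc N"
    using degree_mult_le[of "[:-r, 1:]" P] by (simp add: N_def)
  have "poly_act x ([:-r, 1:] * P) \<phi> y =
      (\<Sum>i\<le>Suc N. coeff ([:-r, 1:] * P) i * \<phi> (x ^ i * y))"
    by (rule poly_act_upto[OF deg])
  also have "\<dots> = (\<Sum>i\<le>Suc N. coeff (pCons 0 P) i * \<phi> (x ^ i * y))
      - r * (\<Sum>i\<le>Suc N. coeff P i * \<phi> (x ^ i * y))"
    by (simp add: sum_subtractf sum_distrib_left algebra_simps del: sum.atMost_Suc)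
  also have "(\<Sum>i\<le>Suc N. coeff P i * \<phi> (x ^ i * y)) = (\<Sum>i\<le>N. coeff P i * \<phi> (x ^ i * y))"
    by (simp add: coeff_eq_0 N_def)
  also have "(\<Sum>i\<le>Suc N. coeff (pCons 0 P) i * \<phi> (x ^ i * y)) = (\<Sum>i\<le>N. coeff P i * \<phi> (x ^ Suc i * y))"
    by (subst sum.atMost_Suc_shift) simp
  also have "\<dots> - r * (\<Sum>i\<le>N. coeff P i * \<phi> (x ^ i * y)) =
      poly_act x P (\<lambda>y. \<phi> (x * y) - r * \<phi> y) y"
    by (simp add: poly_act_def N_def sum_subtractf sum_distrib_left algebra_simps)
  finally show "poly_act x ([:-r, 1:] * P) \<phi> y = poly_act x P (\<lambda>y. \<phi> (x * y) - r * \<phi> y) y" .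
qed

text \<open>
  A vector killed by a product of distinct factors \<open>T - r\<close> is a sum of eigenvectors of \<open>T\<close>.  The set \<open>V\<close>
  stands for the joint eigenspace already found for other operators; the summands stay inside
  it because they are obtained from \<open>\<phi>\<close> by applying \<open>T\<close> and linear combinations.
\<close>

lemma eigenvector_decomposition:
  fixes x :: "'k::field_char_0"
  assumes "finite R" and sub: "F.subspace V" and inv: "\<And>\<psi>. \<psi> \<in> V \<Longrightarrow> (\<lambda>y. \<psi> (x * y)) \<in> V"
    and "\<phi> \<in> V" and "poly_act x (\<Prod>r\<in>R. [:-r, 1:]) \<phi> = (\<lambda>y. 0)"
  shows "\<exists>f. (\<forall>r\<in>R. f r \<in> V \<and> (\<forall>y. f r (x * y) = r * f r y)) \<and> (\<forall>y. \<phi> y = (\<Sum>r\<in>R. f r y))"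
  using assms(1,4,5)
proof (induction R arbitrary: \<phi> rule: finite_induct)
  case empty
  then show ?case by (auto simp: poly_act_def fun_eq_iff)
next
  case (insert r R)
  let ?\<psi> = "\<lambda>y. \<phi> (x * y) - r * \<phi> y"
  have "(\<lambda>y. \<phi> (x * y)) - fun_scale r \<phi> \<in> V"
    by (intro F.subspace_diff F.subspace_scale sub inv insert.prems)
  also have "(\<lambda>y. \<phi> (x * y)) - fun_scale r \<phi> = ?\<psi>" by (simp add: fun_scale_def fun_eq_iff)
  finally have "?\<psi> \<in> V" .
  moreover have "poly_act x (\<Prod>r\<in>R. [:-r, 1:]) ?\<psi> = (\<lambda>y. 0)"
    using insert by (simp add: poly_act_linear_factor del: mult_pCons_left)
  ultimately obtain f where f: "\<And>s. s \<in> R \<Longrightarrow> f s \<in> V" "\<And>s y. s \<in> R \<Longrightarrow> f s (x * y) = s * f s y"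
      "\<And>y. ?\<psi> y = (\<Sum>s\<in>R. f s y)"
    using insert.IH[of ?\<psi>] by metis
  \<comment> \<open>\<open>T - r\<close> multiplies the \<open>s\<close>-eigenvector \<open>f s\<close> by \<open>s - r\<close>; dividing it out leaves a remainder that \<open>T - r\<close> kills.\<close>
  define h where "h s y = (if s = r then \<phi> y - (\<Sum>t\<in>R. f t y / (t - r)) else f s y / (s - r))" for s y
  have hs: "h s = fun_scale (1 / (s - r)) (f s)" if "s \<in> R" for s
    using that insert.hyps by (auto simp: h_def fun_scale_def fun_eq_iff)
  have hV: "h s \<in> V" if "s \<in> R" for s
    unfolding hs[OF that] using f(1)[OF that] by (intro F.subspace_scale sub)
  have hr: "h r = \<phi> - (\<Sum>t\<in>R. h t)"
    using insert.hyps by (auto simp: h_def fun_eq_iff sum_fun_apply intro!: sum.cong)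
  have "h r \<in> V" unfolding hr
    using hV insert.prems sub by (intro F.subspace_diff F.subspace_sum) auto
  moreover have "h r (x * y) = r * h r y" for y
  proof -
    have "h r (x * y) - r * h r y = ?\<psi> y - (\<Sum>t\<in>R. f t (x * y) / (t - r) - r * (f t y / (t - r)))"
      by (simp add: h_def sum_subtractf sum_distrib_left algebra_simps)
    also have "(\<Sum>t\<in>R. f t (x * y) / (t - r) - r * (f t y / (t - r))) = (\<Sum>t\<in>R. f t y)"
    proof (rule sum.cong[OF refl])
      fix t assume t: "t \<in> R"
      then have "t - r \<noteq> 0" using insert.hyps by auto
      then show "f t (x * y) / (t - r) - r * (f t y / (t - r)) = f t y"
        using f(2)[OF t] by (simp add: divide_simps) (simp add: algebra_simps)
    qed
    finally show ?thesis using f(3)[of y] by simp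
  qed
  moreover have "h s (x * y) = s * h s y" if "s \<in> R" for s y
    using hs[OF that] f(2)[OF that] by (simp add: fun_scale_def)
  moreover have "\<phi> y = (\<Sum>s\<in>insert r R. h s y)" for y
    using hr insert.hyps by (simp add: sum_fun_apply)
  ultimately show ?case using hV by (intro exI[of _ h]) auto
qed

lemma rat_linear_poly_act:
  assumes "rat_linear \<phi>"
  shows "poly_act x (map_poly of_rat p) \<phi> y = \<phi> (poly (map_poly of_rat p) x * y)"
proof -
  have "poly (map_poly of_rat p) x * y = (\<Sum>i\<le>degree p. of_rat (coeff p i) * (x ^ i * y))"
    by (simp add: poly_altdef sum_distrib_right mult.assoc)
  then show ?thesis
    by (simp add: rat_linear_sum[OF assms] poly_act_def)
qed

definition joint_eigenvectors :: "'k::field_char_0 set \<Rightarrow> ('k \<Rightarrow> complex) set" where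
  "joint_eigenvectors A = {\<psi>. rat_linear \<psi> \<and> (\<forall>a\<in>A. \<exists>r. \<forall>y. \<psi> (a * y) = r * \<psi> y)}"

text \<open>
  Multiplication operators commute, so the eigenvector decompositions for the elements of \<open>A\<close> can be
  refined one after another.
\<close>

lemma rat_linear_in_span_joint_eigenvectors:
  assumes nf: "number_field TYPE('k::field_char_0)" and "finite (A :: 'k set)" and "rat_linear \<phi>"
  shows "\<phi> \<in> F.span (joint_eigenvectors A)"
  using assms(2,3)
proof (induction A rule: finite_induct)
  case empty
  then show ?case by (intro F.span_base) (auto simp: joint_eigenvectors_def)
next
  case (insert b A)
  have "\<psi> \<in> F.span (joint_eigenvectors (insert b A))" if \<psi>: "\<psi> \<in> joint_eigenvectors A" for \<psi>
  proof -
    obtain l where l: "\<And>a y. a \<in> A \<Longrightarrow> \<psi> (a * y) = l a * \<psi> y"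
      using \<psi> bchoice[of A "\<lambda>a r. \<forall>y. \<psi> (a * y) = r * \<psi> y"] unfolding joint_eigenvectors_def by blast
    let ?V = "{\<chi>. rat_linear \<chi> \<and> (\<forall>a\<in>A. \<forall>y. \<chi> (a * y) = l a * \<chi> y)}"
    have sub: "F.subspace ?V"
      unfolding F.subspace_def by (auto simp: rat_linear_def fun_scale_def algebra_simps)
    have inv: "(\<lambda>y. \<chi> (b * y)) \<in> ?V" if "\<chi> \<in> ?V" for \<chi>
      using that by (auto simp: rat_linear_def distrib_left mult.left_commute[of b])
    obtain p :: "rat poly" where p: "p \<noteq> 0" "poly (map_poly of_rat p) b = 0"
      "rsquarefree (map_poly of_rat p :: complex poly)"
      using separable_annihilator[OF nf, of b] by blast
    let ?P = "map_poly of_rat p :: complex poly"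
    let ?R = "{z. poly ?P z = 0}"
    have "?P \<noteq> 0" using p(1) by simp
    then have fin: "finite ?R" by (rule poly_roots_finite)
    have decomp: "smult (lead_coeff ?P) (\<Prod>z\<in>?R. [:-z, 1:]) = ?P"
      by (rule complex_poly_decompose_rsquarefree[OF p(3)])
    have lin: "rat_linear \<psi>" using \<psi> by (simp add: joint_eigenvectors_def)
    have "poly_act b (smult (lead_coeff ?P) (\<Prod>z\<in>?R. [:-z, 1:])) \<psi> y = 0" for y
      unfolding decomp
      using p(2) rat_linear_sum[OF lin, where I="{}"] by (simp add: rat_linear_poly_act[OF lin])
    moreover have "poly_act b (smult c P) \<psi> y = c * poly_act b P \<psi> y" for c P y
      by (cases "c = 0") (simp_all add: poly_act_def sum_distrib_left algebra_simps)
    ultimately have "lead_coeff ?P * poly_act b (\<Prod>z\<in>?R. [:-z, 1:]) \<psi> y = 0" for y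
      by (simp only:)
    then have "poly_act b (\<Prod>z\<in>?R. [:-z, 1:]) \<psi> = (\<lambda>y. 0)"
      using \<open>?P \<noteq> 0\<close> by (simp add: fun_eq_iff)
    moreover have "\<psi> \<in> ?V" using lin l by auto
    ultimately obtain f where "(\<forall>r\<in>?R. f r \<in> ?V \<and> (\<forall>y. f r (b * y) = r * f r y)) \<and>
        (\<forall>y. \<psi> y = (\<Sum>r\<in>?R. f r y))"
      using eigenvector_decomposition[where R = ?R and V = ?V and x = b and \<phi> = \<psi>, OF fin sub inv]
      by blast
    then have f: "\<And>r. r \<in> ?R \<Longrightarrow> f r \<in> ?V" "\<And>r y. r \<in> ?R \<Longrightarrow> f r (b * y) = r * f r y"
        "\<And>y. \<psi> y = (\<Sum>r\<in>?R. f r y)" by simp_all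
    have "f r \<in> joint_eigenvectors (insert b A)" if "r \<in> ?R" for r
      using f(1,2)[OF that] unfolding joint_eigenvectors_def by blast
    then have "(\<Sum>r\<in>?R. f r) \<in> F.span (joint_eigenvectors (insert b A))"
      by (intro F.span_sum F.span_base) auto
    moreover have "\<psi> = (\<Sum>r\<in>?R. f r)" using f(3) by (simp add: fun_eq_iff sum_fun_apply)
    ultimately show ?thesis by simp
  qed
  then have "F.span (joint_eigenvectors A) \<subseteq> F.span (joint_eigenvectors (insert b A))"
    by (intro F.span_minimal subsetI F.subspace_span)
  then show ?case by (rule subsetD) (rule insert.IH[OF insert.prems])
qed


lemma field_homI:
  fixes \<sigma> :: "'a::field \<Rightarrow> 'b::field"
  assumes "\<And>x y. \<sigma> (x + y) = \<sigma> x + \<sigma> y" "\<And>x y. \<sigma> (x * y) = \<sigma> x * \<sigma> y" "\<sigma> 1 = 1"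
  shows "field_hom \<sigma>"
proof -
  have "\<sigma> 0 = 0" by (metis assms(1) add_cancel_right_right)
  with assms show ?thesis by unfold_locales auto
qed

text \<open>
  A joint eigenvector \<open>\<psi>\<close> for a basis is one for all \<open>x\<close>, with \<open>\<psi> (x * y) = \<lambda> x * \<psi> y\<close>; putting \<open>y = 1\<close>
  identifies the eigenvalue as \<open>\<lambda> = \<psi> / \<psi> 1\<close>, which is then additive and multiplicative.
\<close>

lemma rat_linear_in_span_homs:
  assumes nf: "number_field TYPE('k::field_char_0)" and "rat_linear (\<phi> :: 'k \<Rightarrow> complex)"
  shows "\<phi> \<in> F.span {\<sigma>. field_hom \<sigma>}"
proof -
  obtain B :: "'k set" where B: "finite B" "Q.span B = UNIV"
    using nf unfolding number_field_def by blast
  have "\<psi> \<in> F.span {\<sigma>. field_hom \<sigma>}" if "\<psi> \<in> joint_eigenvectors B" for \<psi>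
  proof -
    have lin: "rat_linear \<psi>" and eig: "\<And>b. b \<in> B \<Longrightarrow> \<exists>r. \<forall>y. \<psi> (b * y) = r * \<psi> y"
      using that unfolding joint_eigenvectors_def by auto
    have "\<exists>r. \<forall>y. \<psi> (x * y) = r * \<psi> y" for x
    proof -
      have "x \<in> Q.span B" using B(2) by simp
      then show ?thesis
      proof (induction rule: Q.span_induct_alt)
        case base
        then show ?case using rat_linear_sum[OF lin, where I="{}"] by (intro exI[of _ 0]) simp
      next
        case (step c b y)
        then obtain r s where "\<forall>z. \<psi> (b * z) = r * \<psi> z" "\<forall>z. \<psi> (y * z) = s * \<psi> z" using eig by blast
        then have "\<psi> ((of_rat c * b + y) * z) = (of_rat c * r + s) * \<psi> z" for z
          using lin by (simp add: rat_linear_def distrib_right mult.assoc)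
        then show ?case by blast
      qed
    qed
    then have eigen: "\<psi> (x * y) * \<psi> 1 = \<psi> x * \<psi> y" for x y
      by (metis mult.commute mult.left_commute mult.right_neutral)
    show ?thesis
    proof (cases "\<psi> 1 = 0")
      case True
      with eigen have "\<psi> x = 0" for x by (metis mult_eq_0_iff)
      then have "\<psi> = 0" by (simp add: fun_eq_iff)
      then show ?thesis by (simp add: F.span_zero)
    next
      case False
      define \<sigma> where "\<sigma> = (\<lambda>x. \<psi> x / \<psi> 1)"
      have "field_hom \<sigma>"
      proof (rule field_homI)
        show "\<sigma> (x + y) = \<sigma> x + \<sigma> y" for x y
          using lin by (simp add: \<sigma>_def rat_linear_def add_divide_distrib)
        have "\<psi> (x * y) / \<psi> 1 = (\<psi> (x * y) * \<psi> 1) / (\<psi> 1 * \<psi> 1)" for x y using False by simp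
        then show "\<sigma> (x * y) = \<sigma> x * \<sigma> y" for x y
          unfolding \<sigma>_def eigen by simp
        show "\<sigma> 1 = 1" using False by (simp add: \<sigma>_def)
      qed
      then have "fun_scale (\<psi> 1) \<sigma> \<in> F.span {\<sigma>. field_hom \<sigma>}"
        by (intro F.span_scale F.span_base) simp
      also have "fun_scale (\<psi> 1) \<sigma> = \<psi>" using False by (simp add: fun_scale_def \<sigma>_def)
      finally show ?thesis .
    qed
  qed
  then have "F.span (joint_eigenvectors B) \<subseteq> F.span {\<sigma> :: 'k \<Rightarrow> complex. field_hom \<sigma>}"
    by (intro F.span_minimal subsetI F.subspace_span)
  then show ?thesis
    using rat_linear_in_span_joint_eigenvectors[OF nf B(1) assms(2)] by blast
qed

lemma field_hom_of_rat:
  assumes "field_hom (\<sigma> :: 'a::field_char_0 \<Rightarrow> 'b::field_char_0)"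
  shows "\<sigma> (of_rat q) = of_rat q"
proof -
  interpret field_hom \<sigma> by fact
  show ?thesis
    by (cases q) (simp add: of_rat_rat hom_div hom_of_int)
qed

lemma field_hom_rat_linear:
  assumes "field_hom (\<sigma> :: 'k::field_char_0 \<Rightarrow> complex)"
  shows "rat_linear \<sigma>"
proof -
  interpret field_hom \<sigma> by fact
  show ?thesis
    by (simp add: rat_linear_def hom_add hom_mult field_hom_of_rat[OF assms])
qed

text \<open>
  Dedekind's argument: the relation at \<open>x * y\<close> minus \<open>\<tau> x\<close> times the relation at \<open>y\<close> no longer
  involves \<open>\<tau>\<close>.
\<close>

lemma field_homs_vanishing_combination:
  assumes "finite S" "S \<subseteq> {\<sigma> :: 'k::field \<Rightarrow> complex. field_hom \<sigma>}"
    and "\<And>y. (\<Sum>\<sigma>\<in>S. c \<sigma> * \<sigma> y) = 0"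
  shows "\<forall>\<sigma>\<in>S. c \<sigma> = 0"
  using assms
proof (induction S arbitrary: c rule: finite_induct)
  case (insert \<tau> S)
  interpret t: field_hom \<tau> using insert.prems by auto
  have "c \<sigma> = 0" if \<sigma>: "\<sigma> \<in> S" for \<sigma>
  proof -
    have "c \<sigma> * (\<sigma> x - \<tau> x) = 0" for x
    proof -
      have "(\<Sum>\<sigma>\<in>S. (c \<sigma> * (\<sigma> x - \<tau> x)) * \<sigma> y) = 0" for y
      proof -
        have m: "\<sigma> (x * y) = \<sigma> x * \<sigma> y" if "\<sigma> \<in> insert \<tau> S" for \<sigma>
        proof -
          interpret field_hom \<sigma> using insert.prems that by auto
          show ?thesis by (rule hom_mult)
        qed
        have "0 = (\<Sum>\<sigma>\<in>insert \<tau> S. c \<sigma> * \<sigma> (x * y)) - \<tau> x * (\<Sum>\<sigma>\<in>insert \<tau> S. c \<sigma> * \<sigma> y)"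
          unfolding insert.prems(2) by simp
        also have "\<dots> = (\<Sum>\<sigma>\<in>insert \<tau> S. (c \<sigma> * (\<sigma> x - \<tau> x)) * \<sigma> y)"
          unfolding sum_distrib_left sum_subtractf[symmetric]
          by (rule sum.cong[OF refl]) (simp add: m algebra_simps)
        finally show ?thesis using insert.hyps by simp
      qed
      then show ?thesis using insert.IH[of "\<lambda>\<sigma>. c \<sigma> * (\<sigma> x - \<tau> x)"] insert.prems \<sigma> by auto
    qed
    moreover have "\<sigma> \<noteq> \<tau>" using insert.hyps \<sigma> by blast
    then obtain x where "\<sigma> x - \<tau> x \<noteq> 0" by (auto simp: fun_eq_iff)
    ultimately show ?thesis using mult_eq_0_iff by blast
  qed
  note S0 = this
  have "(\<Sum>\<sigma>\<in>S. c \<sigma> * \<sigma> 1) = 0" using S0 by (intro sum.neutral ballI) simp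
  with insert.prems(2)[of 1] have "c \<tau> * \<tau> 1 = 0"
    by (simp only: sum.insert[OF insert.hyps] add_0_right)
  then have "c \<tau> = 0" by (simp only: t.hom_one mult_1_right)
  with S0 show ?case by blast
qed simp

lemma field_homs_independent: "F.independent {\<sigma> :: 'k::field \<Rightarrow> complex. field_hom \<sigma>}"
  unfolding F.independent_explicit_module
proof (intro allI impI)
  fix t :: "('k \<Rightarrow> complex) set" and u v
  assume t: "finite t" "t \<subseteq> {\<sigma>. field_hom \<sigma>}" "(\<Sum>v\<in>t. fun_scale (u v) v) = 0" "v \<in> t"
  have "(\<Sum>\<sigma>\<in>t. u \<sigma> * \<sigma> y) = 0" for y
    using arg_cong[OF t(3), of "\<lambda>f. f y"] by (simp add: sum_fun_apply fun_scale_def)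
  with t show "u v = 0" using field_homs_vanishing_combination[of t u] by blast
qed

text \<open>
  The coordinate functions of a basis form the dual basis, which shows that the space of
  rational-linear maps has the dimension of the field.
\<close>

definition coordinate :: "'k::field_char_0 set \<Rightarrow> 'k \<Rightarrow> 'k \<Rightarrow> complex" where
  "coordinate B b x = of_rat (Q.representation B x b)"

context
  fixes B :: "'k::field_char_0 set"
  assumes B: "finite B" "Q.independent B" "Q.span B = UNIV"
begin

lemma coordinate_rat_linear: "rat_linear (coordinate B b)"
  using B by (simp add: rat_linear_def coordinate_def Q.representation_add Q.representation_scale
      of_rat_add of_rat_mult)

lemma basis_expansion: "x = (\<Sum>b\<in>B. of_rat (Q.representation B x b) * b)"
proof -
  have "x \<in> Q.span B" using B(3) by blast
  from Q.sum_representation_eq[OF B(2) this B(1) order.refl] show ?thesis by (rule sym)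
qed

lemma coordinate_basis: "b \<in> B \<Longrightarrow> b' \<in> B \<Longrightarrow> coordinate B b b' = (if b = b' then 1 else 0)"
  using Q.representation_basis[OF B(2), of b'] by (auto simp: coordinate_def)

lemma coordinate_expansion:
  assumes "rat_linear \<phi>"
  shows "\<phi> = (\<Sum>b\<in>B. fun_scale (\<phi> b) (coordinate B b))"
proof
  fix x
  have "\<phi> x = (\<Sum>b\<in>B. of_rat (Q.representation B x b) * \<phi> b)"
    by (subst basis_expansion[of x]) (rule rat_linear_sum[OF assms])
  then show "\<phi> x = (\<Sum>b\<in>B. fun_scale (\<phi> b) (coordinate B b)) x"
    by (simp add: sum_fun_apply fun_scale_def coordinate_def mult.commute)
qed

lemma inj_on_coordinate: "inj_on (coordinate B) B"
  by (rule inj_onI) (metis coordinate_basis zero_neq_one)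

lemma coordinate_independent: "F.independent (coordinate B ` B)"
proof -
  have "\<forall>v\<in>coordinate B ` B. u v = 0"
    if zero: "(\<Sum>v\<in>coordinate B ` B. fun_scale (u v) v) = 0" for u
  proof -
    have "u (coordinate B b') = 0" if b': "b' \<in> B" for b'
    proof -
      have "(\<Sum>v\<in>coordinate B ` B. fun_scale (u v) v) b' = (\<Sum>b\<in>B. u (coordinate B b) * coordinate B b b')"
        by (simp add: sum.reindex[OF inj_on_coordinate] sum_fun_apply fun_scale_def)
      then have "(\<Sum>b\<in>B. u (coordinate B b) * coordinate B b b') = 0"
        unfolding zero by simp
      moreover have "(\<Sum>b\<in>B. u (coordinate B b) * coordinate B b b') = (\<Sum>b\<in>B. if b = b' then u (coordinate B b) else 0)"
        using b' by (intro sum.cong) (auto simp: coordinate_basis)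
      moreover have "\<dots> = u (coordinate B b')" using b' B(1) by simp
      ultimately show ?thesis by simp
    qed
    then show ?thesis by blast
  qed
  then show ?thesis
    by (subst F.dependent_finite[OF finite_imageI[OF B(1)]]) blast
qed

end

text \<open>
  The embeddings and the dual basis are two bases of the same complex vector space.
\<close>

theorem field_homs_card:
  assumes nf: "number_field TYPE('k::field_char_0)"
  shows "finite {\<sigma> :: 'k \<Rightarrow> complex. field_hom \<sigma>}"
    and "card {\<sigma> :: 'k \<Rightarrow> complex. field_hom \<sigma>} = field_degree TYPE('k)"
proof -
  let ?E = "{\<sigma> :: 'k \<Rightarrow> complex. field_hom \<sigma>}"
  obtain B :: "'k set" where B: "finite B" "Q.independent B" "Q.span B = UNIV"
    and card: "card B = field_degree TYPE('k)"
    using number_field_basis[OF nf] by blast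
  note fin = finite_imageI[OF B(1), of "coordinate B"]
  have "?E \<subseteq> F.span (coordinate B ` B)"
  proof
    fix \<sigma> :: "'k \<Rightarrow> complex" assume "\<sigma> \<in> ?E"
    then have *: "rat_linear \<sigma>" using field_hom_rat_linear by blast
    have "(\<Sum>b\<in>B. fun_scale (\<sigma> b) (coordinate B b)) \<in> F.span (coordinate B ` B)"
      by (intro F.span_sum F.span_scale F.span_base) auto
    then show "\<sigma> \<in> F.span (coordinate B ` B)" using coordinate_expansion[OF B *] by simp
  qed
  note le = F.independent_span_bound[OF fin field_homs_independent this]
  from le show "finite ?E" by simp
  moreover have "coordinate B ` B \<subseteq> F.span ?E"
    using rat_linear_in_span_homs[OF nf coordinate_rat_linear[OF B]] by blast
  ultimately have "card (coordinate B ` B) \<le> card ?E"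
    using F.independent_span_bound[OF _ coordinate_independent[OF B]] by blast
  with le show "card ?E = field_degree TYPE('k)"
    by (simp add: card_image[OF inj_on_coordinate[OF B]] card)
qed

section \<open>Integral bases and the discriminant\<close>

interpretation Z: Modules.module "int_scale :: int \<Rightarrow> 'k::field_char_0 \<Rightarrow> 'k"
  by unfold_locales (simp_all add: algebra_simps)

lemma Q_span_finite:
  assumes "finite (S :: 'k::field_char_0 set)" "x \<in> Q.span S"
  obtains q where "x = (\<Sum>v\<in>S. of_rat (q v) * v)"
  using assms Q.span_finite[OF assms(1)] by blast

lemma Z_span_finite:
  assumes "finite (S :: 'k::field_char_0 set)" "x \<in> Z.span S"
  obtains c where "x = (\<Sum>v\<in>S. of_int (c v) * v)"
  using assms Z.span_finite[OF assms(1)] by blast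

text \<open>
  A linear dependence between the rows is a combination of embeddings that vanishes on a spanning
  set, hence everywhere.
\<close>

lemma embedding_det_nonzero:
  fixes \<omega> :: "'k::field_char_0 list"
  assumes nf: "number_field TYPE('k)" and \<sigma>: "embedding_list \<sigma>"
    and len: "length \<omega> = field_degree TYPE('k)" and span: "Q.span (set \<omega>) = UNIV"
    and d: "d = field_degree TYPE('k)"
  shows "det (mat d d (\<lambda>(i, j). (\<sigma> ! i) (\<omega> ! j))) \<noteq> 0"
proof
  assume 0: "det (mat d d (\<lambda>(i, j). (\<sigma> ! i) (\<omega> ! j))) = 0"
  let ?A = "mat d d (\<lambda>(j, i). (\<sigma> ! i) (\<omega> ! j))"
  have "transpose_mat (mat d d (\<lambda>(i, j). (\<sigma> ! i) (\<omega> ! j))) = ?A" by (intro eq_matI) auto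
  with 0 have "det ?A = 0"
    using det_transpose[of "mat d d (\<lambda>(i, j). (\<sigma> ! i) (\<omega> ! j))" d] by simp
  then obtain v where v: "v \<in> carrier_vec d" "v \<noteq> 0\<^sub>v d" "?A *\<^sub>v v = 0\<^sub>v d"
    using det_0_iff_vec_prod_zero_field[of ?A d] by auto
  have dist: "distinct \<sigma>" and set: "set \<sigma> = {\<tau>. field_hom \<tau>}" using \<sigma> by (auto simp: embedding_list_def)
  then have "length \<sigma> = d" using field_homs_card(2)[OF nf] d by (metis distinct_card)
  define \<phi> where "\<phi> x = (\<Sum>i<d. v $ i * (\<sigma> ! i) x)" for x
  have hom: "rat_linear (\<sigma> ! i)" if "i < d" for i
    using that set \<open>length \<sigma> = d\<close> by (intro field_hom_rat_linear) (use nth_mem in blast)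
  have lin: "rat_linear \<phi>"
    unfolding rat_linear_def
  proof (intro conjI allI)
    fix x y show "\<phi> (x + y) = \<phi> x + \<phi> y"
      using hom by (simp add: \<phi>_def rat_linear_def distrib_left sum.distrib)
  next
    fix q x show "\<phi> (of_rat q * x) = of_rat q * \<phi> x"
      using hom by (simp add: \<phi>_def rat_linear_def sum_distrib_left mult.left_commute)
  qed
  have zero: "\<phi> w = 0" if w: "w \<in> set \<omega>" for w
  proof -
    obtain j where j: "j < d" "w = \<omega> ! j" using w len d by (metis in_set_conv_nth)
    have "(?A *\<^sub>v v) $ j = \<phi> w"
      using j v(1) by (simp add: scalar_prod_def \<phi>_def lessThan_atLeast0 mult.commute)
    then show ?thesis using v(3) j by simp
  qed
  have "\<phi> x = 0" for x
  proof -
    have "x \<in> Q.span (set \<omega>)" using span by simp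
    then obtain q where "x = (\<Sum>v\<in>set \<omega>. of_rat (q v) * v)"
      by (rule Q_span_finite[OF finite_set])
    then show ?thesis
      using zero by (simp add: rat_linear_sum[OF lin])
  qed
  moreover have bij: "bij_betw ((!) \<sigma>) {..<d} (set \<sigma>)"
    using dist \<open>length \<sigma> = d\<close> by (intro bij_betw_nth) auto
  have "\<phi> x = (\<Sum>\<tau>\<in>set \<sigma>. v $ (inv_into {..<d} ((!) \<sigma>) \<tau>) * \<tau> x)" for x
    unfolding \<phi>_def
    by (subst sum.reindex_bij_betw[OF bij, symmetric])
       (intro sum.cong refl, simp add: bij_betw_inv_into_left[OF bij])
  ultimately have "(\<Sum>\<tau>\<in>set \<sigma>. v $ (inv_into {..<d} ((!) \<sigma>) \<tau>) * \<tau> x) = 0" for x by metis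
  then have *: "\<forall>\<tau>\<in>set \<sigma>. v $ (inv_into {..<d} ((!) \<sigma>) \<tau>) = 0"
    by (intro field_homs_vanishing_combination) (auto simp: set[symmetric])
  have "v $ i = 0" if "i < d" for i
  proof -
    have "inv_into {..<d} ((!) \<sigma>) (\<sigma> ! i) = i"
      using bij_betw_inv_into_left[OF bij] that by simp
    moreover have "\<sigma> ! i \<in> set \<sigma>" using that \<open>length \<sigma> = d\<close> by simp
    ultimately show ?thesis using * by metis
  qed
  with v(1) have "v = 0\<^sub>v d" by (intro eq_vecI) auto
  with v(2) show False by simp
qed

text \<open>
  This is the step that makes a finitely generated torsion-free abelian group free.  The induction is on
  the sum of the absolute values of the coefficients: if \<open>\<bar>u y\<bar> \<le> \<bar>u x\<bar>\<close>, replacing the generator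
  \<open>y\<close> by \<open>y + s x\<close> turns the coefficient \<open>u x\<close> into \<open>u x - s u y\<close>, which is smaller for the right sign \<open>s\<close>.
\<close>

lemma shorten_generating_set:
  fixes S :: "'k::field_char_0 set"
  assumes "finite S" "(\<Sum>v\<in>S. of_int (u v) * v) = 0" "\<exists>v\<in>S. u v \<noteq> 0"
  shows "\<exists>S'. finite S' \<and> card S' < card S \<and> Z.span S' = Z.span S"
  using assms
proof (induction "\<Sum>v\<in>S. nat \<bar>u v\<bar>" arbitrary: S u rule: less_induct)
  case less
  obtain a where a: "a \<in> S" "u a \<noteq> 0" using less.prems(3) by blast
  show ?case
  proof (cases "\<forall>v\<in>S. v \<noteq> a \<longrightarrow> u v = 0")
    case True
    have "(\<Sum>v\<in>S. of_int (u v) * v) = (\<Sum>v\<in>{a}. of_int (u v) * v)"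
      using True a less.prems(1) by (intro sum.mono_neutral_right) auto
    \<comment> \<open>A relation with a single nonzero coefficient says that the generator itself is zero.\<close>
    then have "a = 0" using less.prems(2) a by simp
    have "Z.span (S - {0}) = Z.span S"
      by (rule Z.span_eq[THEN iffD2]) (auto intro: Z.span_base Z.span_zero)
    moreover have "card (S - {0}) < card S"
      using less.prems(1) a \<open>a = 0\<close> by (intro psubset_card_mono) auto
    ultimately show ?thesis using less.prems(1) by blast
  next
    case False
    then obtain b where b: "b \<in> S" "b \<noteq> a" "u b \<noteq> 0" by blast
    obtain x y where xy: "x \<in> S" "y \<in> S" "x \<noteq> y" "u x \<noteq> 0" "u y \<noteq> 0" "\<bar>u y\<bar> \<le> \<bar>u x\<bar>"
      using a b by (metis linear)
    define s where "s = sgn (u x) * sgn (u y)"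
    define z where "z = y + of_int s * x"
    define R where "R = S - {x, y}"
    define S' where "S' = insert z (S - {y})"
    have S_split: "S = insert x (insert y R)" "finite R" "x \<notin> R" "y \<notin> R"
      using xy less.prems(1) by (auto simp: R_def)
    have S'_split: "S' = insert x (insert z R)" using xy by (auto simp: S'_def R_def)
    have y_eq: "y = z - of_int s * x" by (simp add: z_def)
    have "y \<in> Z.span S'"
      unfolding y_eq by (intro Z.span_diff Z.span_scale Z.span_base) (auto simp: S'_split)
    moreover have "z \<in> Z.span S"
      unfolding z_def by (intro Z.span_add Z.span_scale Z.span_base xy)
    ultimately have span: "Z.span S' = Z.span S"
      by (intro Z.span_eq[THEN iffD2]) (auto simp: S'_def intro: Z.span_base)
    show ?thesis
    proof (cases "z \<in> S - {y}")
      case True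
      then have "S' = S - {y}" by (auto simp: S'_def)
      moreover have "card (S - {y}) < card S" using less.prems(1) xy(2) by (rule card_Diff1_less)
      ultimately show ?thesis using span less.prems(1) by (intro exI[of _ S']) simp
    next
      case False
      have zR: "z \<noteq> x" "z \<notin> R" using False xy by (auto simp: R_def)
      have card: "card S' = card S"
        using S_split S'_split zR xy by simp
      define u' where "u' v = (if v = x then u x - s * u y else if v = z then u y else u v)" for v
      have uR: "u' v = u v" if "v \<in> R" for v using that zR S_split by (auto simp: u'_def)
      have ux: "u' x = u x - s * u y" "u' z = u y" using zR by (auto simp: u'_def)
      have rel: "(\<Sum>v\<in>S'. of_int (u' v) * v) = 0"
      proof -
        have "(\<Sum>v\<in>S'. of_int (u' v) * v) =
            of_int (u x - s * u y) * x + (of_int (u y) * z + (\<Sum>v\<in>R. of_int (u v) * v))"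
          unfolding S'_split using zR S_split uR ux by simp
        also have "\<dots> = of_int (u x) * x + (of_int (u y) * y + (\<Sum>v\<in>R. of_int (u v) * v))"
          by (simp add: z_def algebra_simps)
        also have "\<dots> = (\<Sum>v\<in>S. of_int (u v) * v)"
          unfolding S_split(1) using S_split xy by simp
        finally show ?thesis using less.prems(2) by simp
      qed
      have "\<bar>u x - s * u y\<bar> < \<bar>u x\<bar>"
        using xy(4-6) by (cases "u x > 0"; cases "u y > 0") (simp_all add: s_def)
      then have "(\<Sum>v\<in>S'. nat \<bar>u' v\<bar>) < (\<Sum>v\<in>S. nat \<bar>u v\<bar>)"
        unfolding S_split(1) S'_split using S_split zR xy uR ux by simp
      from less.hyps[OF this _ rel] xy(5) ux(2)
      obtain S'' where "finite S''" "card S'' < card S'" "Z.span S'' = Z.span S'"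
        using less.prems(1) by (auto simp: S'_def)
      with card span show ?thesis by auto
    qed
  qed
qed

lemma exists_integral_basis:
  assumes "finite A" "ring_of_integers = Z.span (A :: 'k::field_char_0 set)"
  shows "\<exists>\<omega> :: 'k list. integral_basis \<omega>"
proof -
  let ?P = "\<lambda>S :: 'k set. finite S \<and> Z.span S = ring_of_integers"
  define S where "S = arg_min card ?P"
  have S: "finite S" "Z.span S = ring_of_integers" and min: "\<And>S'. ?P S' \<Longrightarrow> card S \<le> card S'"
    unfolding S_def using arg_min_natI[of ?P A card] arg_min_nat_le[of ?P _ card] assms by auto
  have free: "\<forall>v\<in>S. u v = 0" if "(\<Sum>v\<in>S. of_int (u v) * v) = 0" for u
    using shorten_generating_set[OF S(1) that] min S by (metis not_less)
  obtain \<omega> where \<omega>: "set \<omega> = S" "distinct \<omega>" using finite_distinct_list[OF S(1)] by blast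
  have bij: "bij_betw ((!) \<omega>) {..<length \<omega>} S"
    using \<omega> by (intro bij_betw_nth) auto
  define idx where "idx = inv_into {..<length \<omega>} ((!) \<omega>)"
  have idx: "idx (\<omega> ! i) = i" if "i < length \<omega>" for i
    unfolding idx_def using bij_betw_inv_into_left[OF bij] that by simp
  have sum: "(\<Sum>i<length \<omega>. of_int (f (\<omega> ! i)) * \<omega> ! i) = (\<Sum>v\<in>S. of_int (f v) * v)" for f
    by (rule sum.reindex_bij_betw[OF bij])
  have "inj_on (\<lambda>c :: int list. \<Sum>i<length \<omega>. of_int (c ! i) * \<omega> ! i) {c. length c = length \<omega>}"
  proof (rule inj_onI)
    fix c c' :: "int list"
    assume c: "c \<in> {c. length c = length \<omega>}" "c' \<in> {c. length c = length \<omega>}"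
      and eq: "(\<Sum>i<length \<omega>. of_int (c ! i) * \<omega> ! i) = (\<Sum>i<length \<omega>. of_int (c' ! i) * \<omega> ! i)"
    define u where "u v = c ! idx v - c' ! idx v" for v
    have "(\<Sum>v\<in>S. of_int (u v) * v) = (\<Sum>i<length \<omega>. of_int (u (\<omega> ! i)) * \<omega> ! i)"
      by (rule sum[symmetric])
    also have "\<dots> = 0" using eq by (simp add: u_def idx algebra_simps sum_subtractf)
    finally have "\<forall>v\<in>S. u v = 0" by (rule free)
    then have "c ! i = c' ! i" if "i < length \<omega>" for i
      using \<omega>(1) nth_mem[OF that] idx[OF that] by (auto simp: u_def)
    then show "c = c'" using c by (intro nth_equalityI) auto
  qed
  moreover have "(\<lambda>c :: int list. \<Sum>i<length \<omega>. of_int (c ! i) * \<omega> ! i) ` {c. length c = length \<omega>} = ring_of_integers"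
  proof (intro equalityI subsetI)
    fix x assume "x \<in> (\<lambda>c :: int list. \<Sum>i<length \<omega>. of_int (c ! i) * \<omega> ! i) ` {c. length c = length \<omega>}"
    then obtain c :: "int list" where "x = (\<Sum>i<length \<omega>. of_int (c ! i) * \<omega> ! i)" by blast
    then show "x \<in> ring_of_integers"
      unfolding S(2)[symmetric] \<omega>(1)[symmetric]
      by (simp only:) (intro Z.span_sum Z.span_scale Z.span_base nth_mem, simp)
  next
    fix x :: 'k assume "x \<in> ring_of_integers"
    then have "x \<in> Z.span S" using S(2) by simp
    then obtain u where u: "x = (\<Sum>v\<in>S. of_int (u v) * v)"
      by (rule Z_span_finite[OF S(1)])
    show "x \<in> (\<lambda>c :: int list. \<Sum>i<length \<omega>. of_int (c ! i) * \<omega> ! i) ` {c. length c = length \<omega>}"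
    proof (rule image_eqI[of _ _ "map u \<omega>"])
      have "(\<Sum>i<length \<omega>. of_int (map u \<omega> ! i) * \<omega> ! i) = (\<Sum>i<length \<omega>. of_int (u (\<omega> ! i)) * \<omega> ! i)"
        by (intro sum.cong) auto
      then show "x = (\<Sum>i<length \<omega>. of_int (map u \<omega> ! i) * \<omega> ! i)"
        unfolding sum u by (rule sym)
    qed simp
  qed
  ultimately show ?thesis
    unfolding integral_basis_def bij_betw_def by (intro exI[of _ \<omega>] conjI)
qed

text \<open>
  If \<open>p\<close> has degree \<open>n\<close> and leading coefficient \<open>a\<close>, then \<open>a\<^sup>n\<^sup>-\<^sup>1 p(X / a)\<close> is monic and integral.
\<close>

lemma integral_multiple:
  assumes "number_field TYPE('k::field_char_0)"
  shows "\<exists>m :: int. m \<noteq> 0 \<and> algebraic_int (of_int m * (x :: 'k))"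
proof -
  obtain p :: "rat poly" where "p \<noteq> 0" "poly (map_poly of_rat p) x = 0"
    using algebraic_over_rat[OF assms] by blast
  then have "algebraic x"
    by (intro algebraicI'[of "map_poly of_rat p"]) auto
  then obtain p :: "int poly" where p: "p \<noteq> 0" "poly (map_poly of_int p) x = 0"
    by (rule algebraicE')
  define n a where "n = degree p" and "a = lead_coeff p"
  have "n > 0"
  proof (rule ccontr)
    assume "\<not> n > 0"
    then obtain c where "p = [:c:]" using n_def by (metis degree_eq_zeroE neq0_conv)
    with p show False by (auto simp: map_poly_pCons)
  qed
  define q :: "'k poly" where "q = monom 1 n + (\<Sum>i<n. monom (of_int (a ^ (n - 1 - i) * coeff p i)) i)"
  have coeff_q: "coeff q i = (if i = n then 1 else if i < n then of_int (a ^ (n - 1 - i) * coeff p i) else 0)" for i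
    by (simp add: q_def coeff_sum)
  have "degree q = n"
  proof (rule antisym)
    show "degree q \<le> n" by (rule degree_le) (simp add: coeff_q)
    show "n \<le> degree q" by (rule le_degree) (simp add: coeff_q)
  qed
  then have "lead_coeff q = 1" by (simp add: coeff_q)
  moreover have "\<forall>i. coeff q i \<in> \<int>" by (simp add: coeff_q)
  moreover have "poly q (of_int a * x) = 0"
  proof -
    have pw: "(of_int a :: 'k) ^ (n - 1 - i) * of_int a ^ i = of_int a ^ (n - 1)" if "i < n" for i
      using that by (simp flip: power_add)
    have "poly q (of_int a * x) =
        of_int a ^ n * x ^ n + (\<Sum>i<n. of_int a ^ (n - 1 - i) * of_int (coeff p i) * (of_int a ^ i * x ^ i))"
      by (simp add: q_def poly_monom poly_sum power_mult_distrib)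
    also have "(\<Sum>i<n. of_int a ^ (n - 1 - i) * of_int (coeff p i) * (of_int a ^ i * x ^ i)) =
        (\<Sum>i<n. of_int a ^ (n - 1) * (of_int (coeff p i) * x ^ i))"
    proof (rule sum.cong[OF refl])
      fix i assume "i \<in> {..<n}"
      then show "(of_int a :: 'k) ^ (n - 1 - i) * of_int (coeff p i) * (of_int a ^ i * x ^ i) =
          of_int a ^ (n - 1) * (of_int (coeff p i) * x ^ i)"
        using pw[of i] by (metis (no_types, lifting) lessThan_iff mult.assoc mult.left_commute)
    qed
    also have "(of_int a :: 'k) ^ n = of_int a ^ (n - 1) * of_int a"
      using \<open>n > 0\<close> by (simp flip: power_Suc2)
    also have "of_int a ^ (n - 1) * of_int a * x ^ n + (\<Sum>i<n. of_int a ^ (n - 1) * (of_int (coeff p i) * x ^ i)) =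
        of_int a ^ (n - 1) * (of_int a * x ^ n + (\<Sum>i<n. of_int (coeff p i) * x ^ i))"
      by (simp add: distrib_left sum_distrib_left mult.assoc)
    also have "of_int a * x ^ n + (\<Sum>i<n. of_int (coeff p i) * x ^ i) = poly (map_poly of_int p) x"
      by (simp add: poly_altdef n_def a_def lessThan_Suc_atMost[symmetric] add.commute)
    finally show ?thesis using p by simp
  qed
  ultimately have "algebraic_int (of_int a * x)" by (rule algebraic_int.intros)
  moreover have "a \<noteq> 0" using p by (simp add: a_def)
  ultimately show ?thesis by blast
qed

lemma rat_span_of_int_span:
  assumes nf: "number_field TYPE('k::field_char_0)" and "finite A"
    and "ring_of_integers \<subseteq> Z.span (A :: 'k set)"
  shows "Q.span A = UNIV"
proof (intro equalityI subsetI UNIV_I)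
  fix x :: 'k
  obtain m :: int where m: "m \<noteq> 0" "algebraic_int (of_int m * x)" using integral_multiple[OF nf] by blast
  then have "of_int m * x \<in> ring_of_integers" by (simp add: ring_of_integers_def)
  then have "of_int m * x \<in> Z.span A" by (rule subsetD[OF assms(3)])
  then obtain c where c: "of_int m * x = (\<Sum>v\<in>A. of_int (c v) * v)" by (rule Z_span_finite[OF assms(2)])
  have "of_rat (of_int (c v)) * v \<in> Q.span A" if "v \<in> A" for v
    using that by (intro Q.span_scale Q.span_base)
  then have "(\<Sum>v\<in>A. of_int (c v) * v) \<in> Q.span A" by (intro Q.span_sum) simp
  then have "of_rat (inverse (of_int m)) * (\<Sum>v\<in>A. of_int (c v) * v) \<in> Q.span A" by (rule Q.span_scale)
  also have "of_rat (inverse (of_int m)) * (\<Sum>v\<in>A. of_int (c v) * v) = x"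
    unfolding c[symmetric] using m by (simp add: of_rat_inverse)
  finally show "x \<in> Q.span A" .
qed

lemma common_denominator:
  fixes q :: "'i \<Rightarrow> rat"
  assumes "finite I"
  shows "\<exists>N :: int. N \<noteq> 0 \<and> (\<forall>i\<in>I. of_int N * q i \<in> \<int>)"
  using assms
proof (induction I rule: finite_induct)
  case empty
  then show ?case by (intro exI[of _ 1]) simp
next
  case (insert a I)
  then obtain N :: int where N: "N \<noteq> 0" "\<And>i. i \<in> I \<Longrightarrow> of_int N * q i \<in> \<int>" by blast
  obtain m k :: int where quot: "quotient_of (q a) = (m, k)" by (rule prod.exhaust)
  note mk = quotient_of_denom_pos[OF quot] quotient_of_div[OF quot]
  have "of_int (k * N) * q i \<in> \<int>" if "i \<in> insert a I" for i
  proof (cases "i = a")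
    case True
    then have "of_int (k * N) * q i = of_int (N * m)" using mk by simp
    then show ?thesis by (metis Ints_of_int)
  next
    case False
    then have "of_int N * q i \<in> \<int>" using that N(2) by blast
    then have "of_int k * (of_int N * q i) \<in> \<int>" by (rule Ints_mult[OF Ints_of_int])
    then show ?thesis by (simp only: of_int_mult mult.assoc)
  qed
  moreover have "k * N \<noteq> 0" using mk(1) N(1) by simp
  ultimately show ?case by blast
qed

text \<open>
  The discriminant evaluates an integral basis at as many positions as the degree of the field, so
  the length of an integral basis has to be known.
\<close>

lemma integral_basis_rat_basis:
  fixes \<omega> :: "'k::field_char_0 list"
  assumes nf: "number_field TYPE('k)" and ib: "integral_basis \<omega>"
  shows "Q.span (set \<omega>) = UNIV" and "length \<omega> = field_degree TYPE('k)"
proof -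
  let ?f = "\<lambda>c :: int list. \<Sum>i<length \<omega>. of_int (c ! i) * \<omega> ! i"
  have inj: "inj_on ?f {c. length c = length \<omega>}" and img: "?f ` {c. length c = length \<omega>} = ring_of_integers"
    using ib unfolding integral_basis_def bij_betw_def by auto
  have indep: "\<forall>i<length \<omega>. c i = 0" if "(\<Sum>i<length \<omega>. of_int (c i) * \<omega> ! i) = 0" for c
  proof -
    have "?f (map c [0..<length \<omega>]) = ?f (replicate (length \<omega>) 0)" using that by simp
    then have "map c [0..<length \<omega>] = replicate (length \<omega>) 0"
      by (rule inj_onD[OF inj]) auto
    then show ?thesis by (metis add_0 diff_zero length_upt nth_map nth_replicate nth_upt)
  qed
  have "?f c \<in> Z.span (set \<omega>)" for c :: "int list"
    by (intro Z.span_sum Z.span_scale Z.span_base nth_mem) simp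
  then have "ring_of_integers \<subseteq> Z.span (set \<omega>)" unfolding img[symmetric] by blast
  then show span: "Q.span (set \<omega>) = UNIV" by (rule rat_span_of_int_span[OF nf finite_set])
  have dist: "distinct \<omega>"
  proof (rule ccontr)
    assume "\<not> distinct \<omega>"
    then obtain i j where ij: "i < length \<omega>" "j < length \<omega>" "i \<noteq> j" "\<omega> ! i = \<omega> ! j"
      by (auto simp: distinct_conv_nth)
    define c where "c k = (if k = i then 1 else if k = j then -1 else 0 :: int)" for k
    have "(\<Sum>k<length \<omega>. of_int (c k) * \<omega> ! k) = (\<Sum>k\<in>{i,j}. of_int (c k) * \<omega> ! k)"
      using ij by (intro sum.mono_neutral_right) (auto simp: c_def)
    also have "\<dots> = 0" using ij by (simp add: c_def)
    finally have "c i = 0" using indep ij by blast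
    then show False by (simp add: c_def)
  qed
  have "Q.independent (set \<omega>)"
  proof
    assume "Q.dependent (set \<omega>)"
    then obtain q w where q: "(\<Sum>v\<in>set \<omega>. of_rat (q v) * v) = 0" and w: "w \<in> set \<omega>" "q w \<noteq> 0"
      using Q.dependent_finite[OF finite_set, of \<omega>] by auto
    obtain N :: int where N: "N \<noteq> 0" "\<forall>v\<in>set \<omega>. of_int N * q v \<in> \<int>"
      using common_denominator[OF finite_set[of \<omega>], of q] by blast
    define c where "c i = \<lfloor>of_int N * q (\<omega> ! i)\<rfloor>" for i
    have c: "of_int (c i) = of_int N * q (\<omega> ! i)" if "i < length \<omega>" for i
      using N(2) nth_mem[OF that] by (auto simp: c_def elim!: Ints_cases)
    have "of_int (c i) * \<omega> ! i = of_int N * (of_rat (q (\<omega> ! i)) * \<omega> ! i)" if "i < length \<omega>" for i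
    proof -
      have "of_int (c i) * \<omega> ! i = of_rat (of_int (c i)) * \<omega> ! i" by simp
      then show ?thesis by (simp only: c[OF that] of_rat_mult of_rat_of_int_eq mult.assoc)
    qed
    then have "(\<Sum>i<length \<omega>. of_int (c i) * \<omega> ! i) = of_int N * (\<Sum>i<length \<omega>. of_rat (q (\<omega> ! i)) * \<omega> ! i)"
      unfolding sum_distrib_left by (intro sum.cong) auto
    also have "(\<Sum>i<length \<omega>. of_rat (q (\<omega> ! i)) * \<omega> ! i) = (\<Sum>v\<in>set \<omega>. of_rat (q v) * v)"
      by (rule sum.reindex_bij_betw) (use dist in \<open>intro bij_betw_nth; auto\<close>)
    finally have 0: "\<forall>i<length \<omega>. c i = 0" using q by (intro indep) simp
    obtain i where "i < length \<omega>" "w = \<omega> ! i" using w by (auto simp: in_set_conv_nth)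
    with 0 c[of i] N(1) w show False by simp
  qed
  then have "card (set \<omega>) = Q.dim (UNIV :: 'k set)"
    using span Q.basis_card_eq_dim[of "set \<omega>" UNIV] by simp
  then show "length \<omega> = field_degree TYPE('k)"
    by (simp add: field_degree_def distinct_card[OF dist])
qed


lemma norm_det_le:
  fixes A :: "complex mat"
  assumes A: "A \<in> carrier_mat d d" and le: "\<And>i j. i < d \<Longrightarrow> j < d \<Longrightarrow> cmod (A $$ (i, j)) \<le> M i"
  shows "cmod (det A) \<le> fact d * (\<Prod>i<d. M i)"
proof -
  have "cmod (det A) \<le> (\<Sum>p\<in>{p. p permutes {0..<d}}. \<Prod>i<d. M i)"
    unfolding det_def'[OF A]
  proof (rule sum_norm_le)
    fix p assume "p \<in> {p. p permutes {0..<d}}"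
    then have p: "p i < d" if "i < d" for i using that permutes_in_image[of p "{0..<d}" i] by auto
    have "cmod (signof p * (\<Prod>i = 0..<d. A $$ (i, p i))) = (\<Prod>i = 0..<d. cmod (A $$ (i, p i)))"
      by (simp add: norm_mult prod_norm sign_def)
    also have "\<dots> \<le> (\<Prod>i = 0..<d. M i)"
      using le p by (intro prod_mono) auto
    finally show "cmod (signof p * (\<Prod>i = 0..<d. A $$ (i, p i))) \<le> (\<Prod>i<d. M i)"
      by (simp add: atLeast0LessThan)
  qed
  also have "\<dots> = fact d * (\<Prod>i<d. M i)"
    by (simp add: card_permutations[of "{0..<d}" d])
  finally show ?thesis .
qed

text \<open>
  The generators in \<open>A\<close> contain a rational basis.  Written in an integral basis it has an integral
  coefficient matrix with nonzero determinant, so its embedding determinant is at least \<open>\<surd>\<bar>\<Delta>\<bar>\<close> in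
  absolute value, while the Leibniz formula bounds it from above.  Positivity keeps \<open>\<surd>\<bar>\<Delta>\<bar>\<close> usable
  as a denominator.
\<close>

theorem discriminant_bound:
  fixes A :: "'k::field_char_0 set"
  assumes nf: "number_field TYPE('k)" and A: "finite A" "ring_of_integers = Z.span A"
    and d: "d = field_degree TYPE('k)"
    and M: "\<And>\<sigma> a. field_hom \<sigma> \<Longrightarrow> a \<in> A \<Longrightarrow> cmod (\<sigma> a) \<le> M \<sigma>"
  shows "0 < sqrt (cmod (discriminant TYPE('k)))"
    and "sqrt (cmod (discriminant TYPE('k))) \<le> fact d * (\<Prod>\<sigma>\<in>{\<sigma>. field_hom \<sigma>}. M \<sigma>)"
proof -
  define \<omega> where "\<omega> = (SOME \<omega> :: 'k list. integral_basis \<omega>)"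
  define \<sigma> where "\<sigma> = (SOME \<sigma> :: ('k \<Rightarrow> complex) list. embedding_list \<sigma>)"
  let ?L = "\<lambda>\<beta>. mat d d (\<lambda>(i, j). (\<sigma> ! i) (\<beta> ! j))"
  have \<omega>: "integral_basis \<omega>"
    unfolding \<omega>_def using exists_integral_basis[OF A] by (rule someI_ex)
  have "\<exists>\<sigma> :: ('k \<Rightarrow> complex) list. embedding_list \<sigma>"
    using finite_distinct_list[OF field_homs_card(1)[OF nf]] unfolding embedding_list_def by auto
  then have \<sigma>: "embedding_list \<sigma>" unfolding \<sigma>_def by (rule someI_ex)
  then have set\<sigma>: "set \<sigma> = {\<sigma>. field_hom \<sigma>}" "distinct \<sigma>" by (auto simp: embedding_list_def)
  then have len\<sigma>: "length \<sigma> = d" using field_homs_card(2)[OF nf] d by (metis distinct_card)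
  have "discriminant TYPE('k) = (det (?L \<omega>))\<^sup>2"
    unfolding discriminant_def Let_def \<omega>_def[symmetric] \<sigma>_def[symmetric] d[symmetric] by (rule refl)
  then have disc: "sqrt (cmod (discriminant TYPE('k))) = cmod (det (?L \<omega>))"
    by (simp add: norm_power)
  note \<omega>_basis = integral_basis_rat_basis[OF nf \<omega>]
  have "det (?L \<omega>) \<noteq> 0"
    by (rule embedding_det_nonzero[OF nf \<sigma> \<omega>_basis(2,1) d])
  then show "0 < sqrt (cmod (discriminant TYPE('k)))" by (simp add: disc)

  obtain B where B: "B \<subseteq> A" "Q.independent B" "A \<subseteq> Q.span B"
    by (rule Q.maximal_independent_subset)
  have "Q.span A \<subseteq> Q.span B" using B(3) by (intro Q.span_minimal Q.subspace_span)
  then have spanB: "Q.span B = UNIV" using rat_span_of_int_span[OF nf A(1)] A(2) by blast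
  then have cardB: "card B = d" using Q.basis_card_eq_dim[of B UNIV] B(2) d by (simp add: field_degree_def)
  have "finite B" using B(1) A(1) by (rule finite_subset)
  then obtain \<beta> where \<beta>: "set \<beta> = B" "distinct \<beta>" using finite_distinct_list by blast
  then have len\<beta>: "length \<beta> = d" using cardB distinct_card by metis
  have det\<beta>: "det (?L \<beta>) \<noteq> 0"
    by (rule embedding_det_nonzero[OF nf \<sigma> _ _ d]) (simp_all add: len\<beta> d[symmetric] \<beta>(1) spanB)
  have "\<exists>c :: int list. \<beta> ! k = (\<Sum>j<d. of_int (c ! j) * \<omega> ! j)" if "k < d" for k
  proof -
    have "\<beta> ! k \<in> A" using that len\<beta> \<beta>(1) B(1) nth_mem by blast
    then have "\<beta> ! k \<in> ring_of_integers" unfolding A(2) by (rule Z.span_base)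
    then show ?thesis
      using \<omega> unfolding integral_basis_def bij_betw_def \<omega>_basis(2) d[symmetric] by blast
  qed
  then obtain C :: "nat \<Rightarrow> int list" where C: "\<And>k. k < d \<Longrightarrow> \<beta> ! k = (\<Sum>j<d. of_int (C k ! j) * \<omega> ! j)"
    by metis
  define CM where "CM = mat d d (\<lambda>(j, k). C k ! j)"
  have "?L \<beta> = ?L \<omega> * map_mat of_int CM"
  proof (rule eq_matI)
    fix i k assume "i < dim_row (?L \<omega> * map_mat of_int CM)" "k < dim_col (?L \<omega> * map_mat of_int CM)"
    then have ik: "i < d" "k < d" by (auto simp: CM_def)
    interpret h: field_hom "\<sigma> ! i" using ik len\<sigma> set\<sigma> nth_mem by blast
    show "?L \<beta> $$ (i, k) = (?L \<omega> * map_mat of_int CM) $$ (i, k)"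
      using ik by (simp add: CM_def scalar_prod_def C h.hom_sum h.hom_mult h.hom_of_int
          lessThan_atLeast0 mult.commute)
  qed (auto simp: CM_def)
  then have det_eq: "det (?L \<beta>) = det (?L \<omega>) * of_int (det CM)"
    by (simp add: det_mult[of _ d] CM_def)
  with det\<beta> have "det CM \<noteq> 0" by auto
  then have "1 \<le> cmod (of_int (det CM))" by simp
  then have "cmod (det (?L \<omega>)) \<le> cmod (det (?L \<beta>))"
    unfolding det_eq norm_mult
    using mult_left_mono[of 1 "cmod (of_int (det CM))" "cmod (det (?L \<omega>))"] by simp
  also have "\<dots> \<le> fact d * (\<Prod>i<d. M (\<sigma> ! i))"
  proof (rule norm_det_le)
    fix i j assume ij: "i < d" "j < d"
    have "\<sigma> ! i \<in> set \<sigma>" "\<beta> ! j \<in> set \<beta>" using ij len\<sigma> len\<beta> by simp_all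
    then have "field_hom (\<sigma> ! i)" "\<beta> ! j \<in> A"
      using set\<sigma>(1) \<beta>(1) B(1) by auto
    then show "cmod (?L \<beta> $$ (i, j)) \<le> M (\<sigma> ! i)" using ij M by simp
  qed simp
  also have "(\<Prod>i<d. M (\<sigma> ! i)) = (\<Prod>\<tau>\<in>set \<sigma>. M \<tau>)"
    by (rule prod.reindex_bij_betw) (use set\<sigma>(2) len\<sigma> in \<open>auto intro: bij_betw_nth\<close>)
  finally show "sqrt (cmod (discriminant TYPE('k))) \<le> fact d * (\<Prod>\<sigma>\<in>{\<sigma>. field_hom \<sigma>}. M \<sigma>)"
    by (simp add: disc set\<sigma>(1))
qed

section \<open>Absolute values and the places over a prime\<close>

text \<open>
  The monic equation expresses \<open>x\<^sup>n\<close> by lower powers with integer coefficients, so the group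
  spanned by the lower powers is stable under multiplication by \<open>x\<close>.
\<close>

lemma algebraic_int_powers_in_span:
  fixes x :: "'k::field_char_0"
  assumes x: "algebraic_int x"
  shows "\<exists>n. \<forall>k. x ^ k \<in> Z.span ((\<lambda>i. x ^ i) ` {..<n})"
proof -
  obtain p where p: "poly (map_poly of_int p) x = 0" "lead_coeff p = 1"
    using x unfolding algebraic_int_altdef_ipoly by blast
  define n where "n = degree p"
  define S where "S = (\<lambda>i. x ^ i) ` {..<n}"
  have "0 = (\<Sum>i\<le>n. of_int (coeff p i) * x ^ i)"
    using p(1) by (simp add: poly_altdef n_def)
  also have "\<dots> = (\<Sum>i<n. of_int (coeff p i) * x ^ i) + x ^ n"
    using p(2) by (simp add: lessThan_Suc_atMost[symmetric] n_def)
  finally have "x ^ n = - (\<Sum>i<n. of_int (coeff p i) * x ^ i)"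
    by (simp add: eq_neg_iff_add_eq_0 add.commute)
  moreover have "(\<Sum>i<n. of_int (coeff p i) * x ^ i) \<in> Z.span S"
    by (intro Z.span_sum Z.span_scale Z.span_base) (simp add: S_def)
  ultimately have xn: "x ^ n \<in> Z.span S" by (simp add: Z.span_neg)
  have closed: "x * y \<in> Z.span S" if "y \<in> Z.span S" for y
    using that
  proof (induction rule: Z.span_induct_alt)
    case base
    then show ?case by (simp add: Z.span_zero)
  next
    case (step c b z)
    then obtain i where i: "i < n" "b = x ^ i" by (auto simp: S_def)
    have "x * b \<in> Z.span S"
    proof (cases "Suc i = n")
      case True
      then show ?thesis using xn i by auto
    next
      case False
      with i have "x * b \<in> S" by (auto simp: S_def intro: image_eqI[of _ _ "Suc i"])
      then show ?thesis by (rule Z.span_base)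
    qed
    then have "of_int c * (x * b) + x * z \<in> Z.span S"
      using step by (intro Z.span_add Z.span_scale)
    then show ?case by (simp add: distrib_left mult.left_commute)
  qed
  have pow: "x ^ k \<in> Z.span S" for k
  proof (induction k)
    case 0
    show ?case
    proof (cases "n = 0")
      case True
      then show ?thesis using xn by simp
    next
      case False
      then have "x ^ 0 \<in> S" unfolding S_def by blast
      then show ?thesis by (rule Z.span_base)
    qed
  next
    case (Suc k)
    then show ?case using closed by simp
  qed
  then show ?thesis unfolding S_def by blast
qed

context
  fixes v :: "'k::field_char_0 \<Rightarrow> real"
  assumes v: "absolute_value v"
begin

lemma absolute_value_nonneg: "v x \<ge> 0"
  and absolute_value_eq_0: "v x = 0 \<longleftrightarrow> x = 0"
  and absolute_value_mult: "v (x * y) = v x * v y"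
  and absolute_value_add: "v (x + y) \<le> v x + v y"
  using v by (auto simp: absolute_value_def)

lemma absolute_value_1: "v 1 = 1"
  using absolute_value_mult[of 1 1] absolute_value_eq_0[of 1] by simp

lemma absolute_value_power: "v (x ^ n) = v x ^ n"
  by (induction n) (simp_all add: absolute_value_1 absolute_value_mult)

lemma absolute_value_prod: "v (\<Prod>i\<in>I. f i) = (\<Prod>i\<in>I. v (f i))"
  by (induction I rule: infinite_finite_induct) (simp_all add: absolute_value_1 absolute_value_mult)

lemma absolute_value_minus: "v (- x) = v x"
proof -
  have "v (-1) * v (-1) = 1" using absolute_value_mult[of "-1" "-1"] by (simp add: absolute_value_1)
  then have "v (-1) = 1" using absolute_value_nonneg[of "-1"] by (simp add: square_eq_1_iff)
  then show ?thesis using absolute_value_mult[of "-1" x] by simp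
qed

lemma absolute_value_minus_commute: "v (x - y) = v (y - x)"
  using absolute_value_minus[of "x - y"] by simp

lemma absolute_value_sum: "v (\<Sum>i\<in>I. f i) \<le> (\<Sum>i\<in>I. v (f i))"
proof (induction I rule: infinite_finite_induct)
  case (insert a I)
  then show ?case using absolute_value_add[of "f a" "sum f I"] by simp
qed (use absolute_value_eq_0[of 0] in simp_all)

lemma absolute_value_diff_le: "\<bar>v x - v y\<bar> \<le> v (x - y)"
  using absolute_value_add[of "x - y" y] absolute_value_add[of "y - x" x]
    absolute_value_minus_commute[of x y] by simp

text \<open>
  All powers of \<open>x\<close> are integral combinations of finitely many fixed powers.  As integers have absolute
  value at most 1, the powers of \<open>v x\<close> are bounded by the triangle inequality alone.
\<close>

lemma absolute_value_algebraic_int_le_1: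
  assumes int: "\<And>m :: int. v (of_int m) \<le> 1" and x: "algebraic_int x"
  shows "v x \<le> 1"
proof (rule ccontr)
  assume "\<not> v x \<le> 1"
  obtain n where pow: "\<And>k. x ^ k \<in> Z.span ((\<lambda>i. x ^ i) ` {..<n})"
    using algebraic_int_powers_in_span[OF x] by blast
  define S where "S = (\<lambda>i. x ^ i) ` {..<n}"
  have "finite S" by (simp add: S_def)
  have "v y \<le> (\<Sum>w\<in>S. v w)" if y: "y \<in> Z.span S" for y
  proof -
    obtain c where c: "y = (\<Sum>w\<in>S. of_int (c w) * w)" using y by (rule Z_span_finite[OF \<open>finite S\<close>])
    have "v y \<le> (\<Sum>w\<in>S. v (of_int (c w) * w))" unfolding c by (rule absolute_value_sum)
    also have "\<dots> \<le> (\<Sum>w\<in>S. v w)"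
      unfolding absolute_value_mult
      by (intro sum_mono mult_left_le_one_le absolute_value_nonneg int)
    finally show ?thesis .
  qed
  from this[OF pow[folded S_def]] have bounded: "v x ^ k \<le> (\<Sum>w\<in>S. v w)" for k by (simp add: absolute_value_power)
  have "1 < v x" using \<open>\<not> v x \<le> 1\<close> by simp
  from real_arch_pow[OF this, of "\<Sum>w\<in>S. v w"] obtain k where "(\<Sum>w\<in>S. v w) < v x ^ k" by blast
  with bounded[of k] show False by simp
qed

end

lemma padic_abs_of_int_le_1:
  assumes "prime p"
  shows "padic_abs p (of_int m) \<le> 1"
proof (cases "m = 0")
  case False
  have p: "real p > 1" using prime_gt_1_nat[OF assms] by simp
  have "multiplicity (int p) 1 = 0" using assms by (intro not_dvd_imp_multiplicity_0) auto
  then have "padic_abs p (of_int m) = inverse (real p ^ multiplicity (int p) m)"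
    using False by (simp add: padic_abs_def power_int_minus)
  also have "\<dots> \<le> 1" using p by (simp add: inverse_le_1_iff)
  finally show ?thesis .
qed (simp add: padic_abs_def)

text \<open>
  Whatever the local degree is, powers of numbers in the unit interval do not exceed 1.
\<close>

lemma local_height_nonarchimedean:
  assumes v: "absolute_value v" and p: "prime p" "\<And>q. v (of_rat q) = padic_abs p q"
    and \<gamma>: "set \<gamma> \<subseteq> ring_of_integers"
  shows "local_height v \<gamma> = 1"
proof -
  have int: "v (of_int m) \<le> 1" for m
    using p(2)[of "of_int m"] padic_abs_of_int_le_1[OF p(1), of m] by (simp only: of_rat_of_int_eq)
  have "v x \<le> 1" if "x \<in> set \<gamma>" for x
  proof (rule absolute_value_algebraic_int_le_1[OF v int])
    show "algebraic_int x" using that \<gamma> unfolding ring_of_integers_def by blast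
  qed
  then have "v x ^ k \<le> 1" if "x \<in> set \<gamma>" for x k
    using that by (intro power_le_one absolute_value_nonneg[OF v])
  then show ?thesis unfolding local_height_def by (intro Max_eqI) auto
qed

section \<open>Archimedean places of a totally real field\<close>

lemma complex_of_rat: "of_rat q = complex_of_real (of_rat q)"
  by (cases q) (simp add: of_rat_rat)

lemma norm_complex_of_rat: "cmod (of_rat q) = \<bar>of_rat q\<bar>"
  by (simp add: complex_of_rat)

text \<open>
  The coordinates of \<open>x\<close> in a rational basis are fixed complex combinations of the values of the
  embeddings at \<open>x\<close>, and \<open>v\<close> is the usual absolute value on the coordinates.
\<close>

lemma archimedean_le_sum_embeddings:
  fixes v :: "'k::field_char_0 \<Rightarrow> real"
  assumes nf: "number_field TYPE('k)" and v: "absolute_value v"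
    and arch: "\<And>q. v (of_rat q) = \<bar>of_rat q\<bar>"
  shows "\<exists>C\<ge>0. \<forall>x. v x \<le> C * (\<Sum>\<sigma>\<in>{\<sigma> :: 'k \<Rightarrow> complex. field_hom \<sigma>}. cmod (\<sigma> x))"
proof -
  let ?E = "{\<sigma> :: 'k \<Rightarrow> complex. field_hom \<sigma>}"
  note fin = field_homs_card(1)[OF nf]
  obtain B :: "'k set" where B: "finite B" "Q.independent B" "Q.span B = UNIV"
    and "card B = field_degree TYPE('k)"
    by (rule number_field_basis[OF nf])
  have "\<exists>c. coordinate B b = (\<Sum>\<sigma>\<in>?E. fun_scale (c \<sigma>) \<sigma>)" for b
    using rat_linear_in_span_homs[OF nf coordinate_rat_linear[OF B]] F.span_finite[OF fin] by blast
  then obtain c where "coordinate B b = (\<Sum>\<sigma>\<in>?E. fun_scale (c b \<sigma>) \<sigma>)" for b by metis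
  then have c: "coordinate B b x = (\<Sum>\<sigma>\<in>?E. c b \<sigma> * \<sigma> x)" for b x
    by (simp add: sum_fun_apply fun_scale_def)
  define C where "C = (\<Sum>b\<in>B. \<Sum>\<sigma>\<in>?E. cmod (c b \<sigma>) * v b)"
  have pos: "0 \<le> cmod (c b \<sigma>) * v b" for b \<sigma> using absolute_value_nonneg[OF v] by simp
  have "v x \<le> C * (\<Sum>\<sigma>\<in>?E. cmod (\<sigma> x))" for x
  proof -
    have coord: "v (of_rat (Q.representation B x b)) = cmod (coordinate B b x)" for b
      by (simp add: arch coordinate_def norm_complex_of_rat)
    have "v x \<le> (\<Sum>b\<in>B. v (of_rat (Q.representation B x b) * b))"
      using arg_cong[OF basis_expansion[OF B, of x], of v]
        absolute_value_sum[OF v, of "\<lambda>b. of_rat (Q.representation B x b) * b" B] by linarith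
    also have "\<dots> = (\<Sum>b\<in>B. cmod (coordinate B b x) * v b)"
      by (simp add: absolute_value_mult[OF v] coord)
    also have "\<dots> \<le> (\<Sum>b\<in>B. (\<Sum>\<sigma>\<in>?E. cmod (c b \<sigma>) * v b) * (\<Sum>\<sigma>\<in>?E. cmod (\<sigma> x)))"
    proof (rule sum_mono)
      fix b assume "b \<in> B"
      have "cmod (coordinate B b x) \<le> (\<Sum>\<sigma>\<in>?E. cmod (c b \<sigma>) * cmod (\<sigma> x))"
        unfolding c norm_mult[symmetric] by (rule norm_sum)
      then have "cmod (coordinate B b x) * v b \<le> (\<Sum>\<sigma>\<in>?E. cmod (c b \<sigma>) * cmod (\<sigma> x)) * v b"
        by (intro mult_right_mono absolute_value_nonneg[OF v])
      also have "\<dots> = (\<Sum>\<sigma>\<in>?E. cmod (c b \<sigma>) * v b * cmod (\<sigma> x))"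
        unfolding sum_distrib_right by (intro sum.cong) (simp_all add: mult_ac)
      also have "\<dots> \<le> (\<Sum>\<sigma>\<in>?E. cmod (c b \<sigma>) * v b * (\<Sum>\<sigma>\<in>?E. cmod (\<sigma> x)))"
        by (intro sum_mono mult_left_mono pos member_le_sum[of _ ?E "\<lambda>\<sigma>. cmod (\<sigma> x)"] fin) auto
      also have "\<dots> = (\<Sum>\<sigma>\<in>?E. cmod (c b \<sigma>) * v b) * (\<Sum>\<sigma>\<in>?E. cmod (\<sigma> x))"
        by (simp add: sum_distrib_right)
      finally show "cmod (coordinate B b x) * v b \<le> \<dots>" .
    qed
    also have "\<dots> = C * (\<Sum>\<sigma>\<in>?E. cmod (\<sigma> x))" by (simp add: C_def sum_distrib_right)
    finally show ?thesis .
  qed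
  moreover have "C \<ge> 0" unfolding C_def by (intro sum_nonneg pos)
  ultimately show ?thesis by blast
qed

text \<open>
  Choose rational numbers \<open>q\<^sub>\<sigma>\<close> close to the real numbers \<open>\<sigma>(x)\<close>.  Every embedding maps
  \<open>z = \<Prod>\<^sub>\<sigma> (x - q\<^sub>\<sigma>)\<close> to a small number, because one of its factors is small.  By the previous bound \<open>v z\<close>
  is small, so some factor \<open>v (x - q\<^sub>\<sigma>)\<close> is small.
\<close>

lemma archimedean_rat_dense:
  fixes v :: "'k::field_char_0 \<Rightarrow> real"
  assumes nf: "number_field TYPE('k)" and tr: "totally_real TYPE('k)" and v: "absolute_value v"
    and arch: "\<And>q. v (of_rat q) = \<bar>of_rat q\<bar>" and e: "e > 0"
  shows "\<exists>q. v (x - of_rat q) < e"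
proof (rule ccontr)
  assume "\<not> ?thesis"
  then have far: "e \<le> v (x - of_rat q)" for q by (simp add: not_less)
  let ?E = "{\<sigma> :: 'k \<Rightarrow> complex. field_hom \<sigma>}"
  note fin = field_homs_card(1)[OF nf]
  from archimedean_le_sum_embeddings[OF nf v arch]
  obtain C where "C \<ge> 0" "\<forall>x. v x \<le> C * (\<Sum>\<sigma>\<in>?E. cmod (\<sigma> x))" by (elim exE conjE)
  note C = this(1) this(2)[rule_format]
  define D where "D \<tau> = (\<Prod>\<sigma>\<in>?E. cmod (\<tau> x) + cmod (\<sigma> x) + 1)" for \<tau> :: "'k \<Rightarrow> complex"
  define S where "S = C * (\<Sum>\<tau>\<in>?E. D \<tau>)"
  have D: "D \<tau> \<ge> 0" for \<tau> unfolding D_def by (intro prod_nonneg) (simp add: add_nonneg_nonneg)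
  have S: "S \<ge> 0" unfolding S_def using C D by (intro mult_nonneg_nonneg sum_nonneg)
  \<comment> \<open>The estimates below give \<open>e ^ card ?E \<le> \<delta> * S\<close>; this \<open>\<delta>\<close> contradicts it.  The summand 1 covers \<open>S = 0\<close>.\<close>
  define \<delta> where "\<delta> = min 1 (e ^ card ?E / (2 * (S + 1)))"
  have \<delta>: "0 < \<delta>" "\<delta> \<le> 1" using e S by (auto simp: \<delta>_def)
  have "\<exists>q :: rat. \<bar>Re (\<sigma> x) - of_rat q\<bar> < \<delta>" for \<sigma> :: "'k \<Rightarrow> complex"
  proof -
    obtain r :: real where r: "r \<in> \<rat>" "Re (\<sigma> x) < r" "r < Re (\<sigma> x) + \<delta>"
      using Rats_dense_in_real[of "Re (\<sigma> x)" "Re (\<sigma> x) + \<delta>"] \<delta> by auto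
    obtain s where "r = of_rat s" using r(1) by (rule Rats_cases)
    with r show ?thesis by (intro exI[of _ s]) simp
  qed
  then obtain q :: "('k \<Rightarrow> complex) \<Rightarrow> rat" where q: "\<And>\<sigma>. \<bar>Re (\<sigma> x) - of_rat (q \<sigma>)\<bar> < \<delta>" by metis
  have near: "cmod (\<sigma> x - of_rat (q \<sigma>)) < \<delta>" if \<sigma>: "\<sigma> \<in> ?E" for \<sigma>
  proof -
    have "range \<sigma> \<subseteq> \<real>" using tr \<sigma> unfolding totally_real_def by simp
    then have "\<sigma> x \<in> \<real>" by (rule subsetD[OF _ rangeI])
    then have "Im (\<sigma> x) = 0" by (simp add: complex_is_Real_iff)
    then have "\<sigma> x - of_rat (q \<sigma>) = of_real (Re (\<sigma> x) - of_rat (q \<sigma>))"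
      by (simp add: complex_eq_iff complex_of_rat)
    then have "cmod (\<sigma> x - of_rat (q \<sigma>)) = \<bar>Re (\<sigma> x) - of_rat (q \<sigma>)\<bar>"
      by (simp only: norm_of_real)
    then show ?thesis using q[of \<sigma>] by (simp only:)
  qed
  define z where "z = (\<Prod>\<sigma>\<in>?E. x - of_rat (q \<sigma>))"
  have small: "cmod (\<tau> z) \<le> \<delta> * D \<tau>" if \<tau>: "\<tau> \<in> ?E" for \<tau>
  proof -
    interpret t: field_hom \<tau> using \<tau> by simp
    have "cmod (\<tau> z) = (\<Prod>\<sigma>\<in>?E. cmod (\<tau> x - of_rat (q \<sigma>)))"
      using \<tau> by (simp add: z_def t.hom_prod t.hom_minus field_hom_of_rat prod_norm)
    also have "\<dots> = cmod (\<tau> x - of_rat (q \<tau>)) * (\<Prod>\<sigma>\<in>?E - {\<tau>}. cmod (\<tau> x - of_rat (q \<sigma>)))"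
      by (rule prod.remove[OF fin \<tau>])
    also have "\<dots> \<le> \<delta> * (\<Prod>\<sigma>\<in>?E - {\<tau>}. cmod (\<tau> x) + cmod (\<sigma> x) + 1)"
    proof (intro mult_mono prod_mono conjI prod_nonneg)
      fix \<sigma> assume "\<sigma> \<in> ?E - {\<tau>}"
      then have "cmod (\<sigma> x - of_rat (q \<sigma>)) < 1" using near \<delta>(2) by force
      moreover have "cmod (\<tau> x - of_rat (q \<sigma>)) \<le> cmod (\<tau> x) + cmod (\<sigma> x) + cmod (\<sigma> x - of_rat (q \<sigma>))"
        using norm_triangle_ineq4[of "\<tau> x" "of_rat (q \<sigma>)"]
          norm_triangle_ineq4[of "\<sigma> x" "\<sigma> x - of_rat (q \<sigma>)"] by simp
      ultimately show "cmod (\<tau> x - of_rat (q \<sigma>)) \<le> cmod (\<tau> x) + cmod (\<sigma> x) + 1" by simp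
    qed (use near[OF \<tau>] \<delta> in auto)
    also have "\<dots> \<le> \<delta> * D \<tau>"
    proof (rule mult_left_mono)
      have "0 \<le> (\<Prod>\<sigma>\<in>?E - {\<tau>}. cmod (\<tau> x) + cmod (\<sigma> x) + 1)"
        by (intro prod_nonneg) (simp add: add_nonneg_nonneg)
      then have "1 * (\<Prod>\<sigma>\<in>?E - {\<tau>}. cmod (\<tau> x) + cmod (\<sigma> x) + 1) \<le>
          (cmod (\<tau> x) + cmod (\<tau> x) + 1) * (\<Prod>\<sigma>\<in>?E - {\<tau>}. cmod (\<tau> x) + cmod (\<sigma> x) + 1)"
        by (intro mult_right_mono) auto
      also have "\<dots> = D \<tau>" unfolding D_def by (rule prod.remove[OF fin \<tau>, symmetric])
      finally show "(\<Prod>\<sigma>\<in>?E - {\<tau>}. cmod (\<tau> x) + cmod (\<sigma> x) + 1) \<le> D \<tau>" by simp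
    qed (use \<delta> in simp)
    finally show ?thesis .
  qed
  have "e ^ card ?E = (\<Prod>\<sigma>\<in>?E. e)" by simp
  also have "\<dots> \<le> (\<Prod>\<sigma>\<in>?E. v (x - of_rat (q \<sigma>)))"
    using e far by (intro prod_mono) auto
  also have "\<dots> = v z" by (simp add: z_def absolute_value_prod[OF v])
  also have "\<dots> \<le> C * (\<Sum>\<tau>\<in>?E. cmod (\<tau> z))" by (rule C(2))
  also have "\<dots> \<le> C * (\<Sum>\<tau>\<in>?E. \<delta> * D \<tau>)"
    using C(1) small by (intro mult_left_mono sum_mono)
  also have "\<dots> = \<delta> * S" by (simp add: S_def sum_distrib_left mult.left_commute)
  also have "\<dots> \<le> e ^ card ?E / (2 * (S + 1)) * S"
    using S by (intro mult_right_mono) (simp_all add: \<delta>_def)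
  also have "\<dots> = e ^ card ?E * (S / (2 * (S + 1)))" by simp
  also have "\<dots> < e ^ card ?E * 1"
    using S e by (intro mult_strict_left_mono) (simp_all add: divide_less_eq)
  finally show False by simp
qed


lemma null_seq_dominated:
  fixes f g :: "nat \<Rightarrow> real"
  assumes "\<And>n. \<bar>f n\<bar> \<le> g n" "g \<longlonglongrightarrow> 0"
  shows "f \<longlonglongrightarrow> 0"
proof (rule tendsto_rabs_zero_cancel)
  show "(\<lambda>n. \<bar>f n\<bar>) \<longlonglongrightarrow> 0"
    by (rule tendsto_sandwich[OF _ _ tendsto_const assms(2)]) (use assms(1) in simp_all)
qed

text \<open>
  On rational numbers \<open>v\<close> is the usual distance.  Rational sequences that converge to \<open>x\<close> for \<open>v\<close> are
  therefore real Cauchy sequences, and their real limit \<open>\<tau> x\<close> does not depend on the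
  sequence.  Independence of the sequence is what makes \<open>\<tau>\<close> a homomorphism.
\<close>

theorem archimedean_place_embedding:
  fixes v :: "'k::field_char_0 \<Rightarrow> real"
  assumes nf: "number_field TYPE('k)" and tr: "totally_real TYPE('k)" and v: "absolute_value v"
    and arch: "\<And>q. v (of_rat q) = \<bar>of_rat q\<bar>"
  shows "\<exists>\<tau> :: 'k \<Rightarrow> real. field_hom \<tau> \<and> v = (\<lambda>x. \<bar>\<tau> x\<bar>)"
proof -
  have "\<exists>q. v (x - of_rat q) < inverse (of_nat (Suc n))" for x n
    by (rule archimedean_rat_dense[OF nf tr v arch]) simp
  then obtain q where q: "\<And>x n. v (x - of_rat (q x n)) < inverse (of_nat (Suc n))" by metis
  have q0: "(\<lambda>n. v (x - of_rat (q x n))) \<longlonglongrightarrow> 0" for x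
  proof (rule tendsto_sandwich[OF _ _ tendsto_const LIMSEQ_inverse_real_of_nat])
    show "\<forall>\<^sub>F n in sequentially. 0 \<le> v (x - of_rat (q x n))"
      by (simp add: absolute_value_nonneg[OF v])
    show "\<forall>\<^sub>F n in sequentially. v (x - of_rat (q x n)) \<le> inverse (real (Suc n))"
      by (intro always_eventually allI less_imp_le q)
  qed
  have arch_diff: "\<bar>of_rat a - of_rat b\<bar> \<le> v (x - of_rat a) + v (x - of_rat b)" for a b and x :: 'k
  proof -
    have "\<bar>of_rat a - of_rat b :: real\<bar> = v (of_rat (a - b))" using arch[of "a - b"] by (simp add: of_rat_diff)
    also have "(of_rat (a - b) :: 'k) = (x - of_rat b) + (of_rat a - x)" by (simp add: of_rat_diff)
    also have "v \<dots> \<le> v (x - of_rat b) + v (of_rat a - x)" by (rule absolute_value_add[OF v])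
    also have "v (of_rat a - x) = v (x - of_rat a)" by (rule absolute_value_minus_commute[OF v])
    finally show ?thesis by simp
  qed
  have "Cauchy (\<lambda>n. of_rat (q x n) :: real)" for x
  proof (rule metric_CauchyI)
    fix e :: real assume "e > 0"
    then have "e / 2 > 0" by simp
    from order_tendstoD(2)[OF q0[of x] this] obtain N where N: "\<And>n. n \<ge> N \<Longrightarrow> v (x - of_rat (q x n)) < e / 2"
      unfolding eventually_sequentially by blast
    have "dist (of_rat (q x m) :: real) (of_rat (q x n)) < e" if "m \<ge> N" "n \<ge> N" for m n
      using arch_diff[of "q x m" "q x n" x] N[OF that(1)] N[OF that(2)] by (simp add: dist_real_def)
    then show "\<exists>M. \<forall>m\<ge>M. \<forall>n\<ge>M. dist (of_rat (q x m) :: real) (of_rat (q x n)) < e" by blast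
  qed
  then have "convergent (\<lambda>n. of_rat (q x n) :: real)" for x by (rule Cauchy_convergent)
  then have "\<exists>r. (\<lambda>n. of_rat (q x n) :: real) \<longlonglongrightarrow> r" for x unfolding convergent_def .
  then obtain \<tau> where \<tau>: "\<And>x. (\<lambda>n. of_rat (q x n) :: real) \<longlonglongrightarrow> \<tau> x" by metis
  have unique: "\<tau> x = r" if lim: "(\<lambda>n. v (x - of_rat (p n))) \<longlonglongrightarrow> 0" "(\<lambda>n. of_rat (p n)) \<longlonglongrightarrow> r" for x p r
  proof -
    have "(\<lambda>n. of_rat (q x n) - of_rat (p n) :: real) \<longlonglongrightarrow> 0"
    proof (rule null_seq_dominated)
      show "\<bar>of_rat (q x n) - of_rat (p n) :: real\<bar> \<le> v (x - of_rat (q x n)) + v (x - of_rat (p n))" for n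
        by (rule arch_diff)
      show "(\<lambda>n. v (x - of_rat (q x n)) + v (x - of_rat (p n))) \<longlonglongrightarrow> 0"
        using tendsto_add[OF q0[of x] lim(1)] by simp
    qed
    moreover have "(\<lambda>n. of_rat (q x n) - of_rat (p n) :: real) \<longlonglongrightarrow> \<tau> x - r"
      by (intro tendsto_diff \<tau> lim(2))
    ultimately have "\<tau> x - r = 0" by (rule LIMSEQ_unique[symmetric])
    then show ?thesis by simp
  qed
  have "field_hom \<tau>"
  proof (rule field_homI)
    fix x y
    show "\<tau> (x + y) = \<tau> x + \<tau> y"
    proof (rule unique[where p = "\<lambda>n. q x n + q y n"])
      show "(\<lambda>n. v (x + y - of_rat (q x n + q y n))) \<longlonglongrightarrow> 0"
      proof (rule null_seq_dominated)
        have "v (x + y - of_rat (q x n + q y n)) \<le> v (x - of_rat (q x n)) + v (y - of_rat (q y n))" for n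
          using absolute_value_add[OF v, of "x - of_rat (q x n)" "y - of_rat (q y n)"]
          by (simp add: of_rat_add algebra_simps)
        then show "\<bar>v (x + y - of_rat (q x n + q y n))\<bar> \<le> v (x - of_rat (q x n)) + v (y - of_rat (q y n))" for n
          by (simp only: abs_of_nonneg[OF absolute_value_nonneg[OF v]])
        show "(\<lambda>n. v (x - of_rat (q x n)) + v (y - of_rat (q y n))) \<longlonglongrightarrow> 0"
          using tendsto_add[OF q0[of x] q0[of y]] by simp
      qed
      show "(\<lambda>n. of_rat (q x n + q y n)) \<longlonglongrightarrow> \<tau> x + \<tau> y"
        unfolding of_rat_add by (intro tendsto_add \<tau>)
    qed
    show "\<tau> (x * y) = \<tau> x * \<tau> y"
    proof (rule unique[where p = "\<lambda>n. q x n * q y n"])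
      show "(\<lambda>n. v (x * y - of_rat (q x n * q y n))) \<longlonglongrightarrow> 0"
      proof (rule null_seq_dominated)
        have "v (x * y - of_rat (q x n * q y n)) \<le>
            v x * v (y - of_rat (q y n)) + \<bar>of_rat (q y n)\<bar> * v (x - of_rat (q x n))" for n
        proof -
          have "x * y - of_rat (q x n * q y n) = x * (y - of_rat (q y n)) + of_rat (q y n) * (x - of_rat (q x n))"
            by (simp add: of_rat_mult algebra_simps)
          then show ?thesis
            using absolute_value_add[OF v, of "x * (y - of_rat (q y n))" "of_rat (q y n) * (x - of_rat (q x n))"]
            by (simp add: absolute_value_mult[OF v] arch)
        qed
        then show "\<bar>v (x * y - of_rat (q x n * q y n))\<bar> \<le>
            v x * v (y - of_rat (q y n)) + \<bar>of_rat (q y n)\<bar> * v (x - of_rat (q x n))" for n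
          by (simp only: abs_of_nonneg[OF absolute_value_nonneg[OF v]])
        have "(\<lambda>n. v x * v (y - of_rat (q y n)) + \<bar>of_rat (q y n)\<bar> * v (x - of_rat (q x n)))
            \<longlonglongrightarrow> v x * 0 + \<bar>\<tau> y\<bar> * 0"
          by (intro tendsto_add tendsto_mult tendsto_const q0 tendsto_rabs \<tau>)
        then show "(\<lambda>n. v x * v (y - of_rat (q y n)) + \<bar>of_rat (q y n)\<bar> * v (x - of_rat (q x n))) \<longlonglongrightarrow> 0"
          by simp
      qed
      show "(\<lambda>n. of_rat (q x n * q y n)) \<longlonglongrightarrow> \<tau> x * \<tau> y"
        unfolding of_rat_mult by (intro tendsto_mult \<tau>)
    qed
  next
    show "\<tau> 1 = 1"
      by (rule unique[where p = "\<lambda>n. 1"]) (simp_all add: absolute_value_eq_0[OF v, THEN iffD2])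
  qed
  moreover have "v x = \<bar>\<tau> x\<bar>" for x
  proof -
    have "(\<lambda>n. v x - \<bar>of_rat (q x n)\<bar>) \<longlonglongrightarrow> 0"
    proof (rule null_seq_dominated[OF _ q0[of x]])
      show "\<bar>v x - \<bar>of_rat (q x n)\<bar>\<bar> \<le> v (x - of_rat (q x n))" for n
        using absolute_value_diff_le[OF v, of x "of_rat (q x n)"] by (simp only: arch)
    qed
    moreover have "(\<lambda>n. v x - \<bar>of_rat (q x n)\<bar>) \<longlonglongrightarrow> v x - \<bar>\<tau> x\<bar>"
      by (intro tendsto_diff tendsto_const tendsto_rabs \<tau>)
    ultimately have "v x - \<bar>\<tau> x\<bar> = 0" by (rule LIMSEQ_unique[symmetric])
    then show ?thesis by simp
  qed
  ultimately show ?thesis by (intro exI[of _ \<tau>]) auto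
qed

section \<open>The local degree at a real place\<close>

text \<open>
  Taking limits identifies the completion at a real place, a quotient of a ring of sequences, with
  this ring.
\<close>

definition real_ring :: "real ring" where
  "real_ring = \<lparr>carrier = UNIV, monoid.mult = (*), one = 1, zero = 0, add = (+)\<rparr>"

lemma field_real_ring: "field real_ring"
proof -
  interpret cring real_ring
  proof (intro cringI abelian_groupI comm_monoidI)
    fix x assume "x \<in> carrier real_ring"
    show "\<exists>y\<in>carrier real_ring. y \<oplus>\<^bsub>real_ring\<^esub> x = \<zero>\<^bsub>real_ring\<^esub>"
      by (rule bexI[of _ "- x"]) (simp_all add: real_ring_def)
  qed (simp_all add: real_ring_def algebra_simps)
  show ?thesis
  proof (rule cring_fieldI2)
    fix a assume "a \<in> carrier real_ring" "a \<noteq> \<zero>\<^bsub>real_ring\<^esub>"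
    then show "\<exists>b\<in>carrier real_ring. a \<otimes>\<^bsub>real_ring\<^esub> b = \<one>\<^bsub>real_ring\<^esub>"
      by (intro bexI[of _ "inverse a"]) (simp_all add: real_ring_def)
  qed (simp add: real_ring_def)
qed

context
  fixes \<tau> :: "'k::field_char_0 \<Rightarrow> real"
  assumes \<tau>: "field_hom \<tau>"
begin

interpretation t: field_hom \<tau> by (rule \<tau>)

lemma cauchy_seqs_iff_convergent: "X \<in> cauchy_seqs (\<lambda>x. \<bar>\<tau> x\<bar>) \<longleftrightarrow> convergent (\<lambda>n. \<tau> (X n))"
  unfolding Cauchy_convergent_iff[symmetric] Cauchy_def cauchy_seqs_def
  by (simp add: dist_real_def t.hom_minus)

lemma cring_cauchy_ring: "cring (cauchy_ring (\<lambda>x. \<bar>\<tau> x\<bar>))"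
proof (intro cringI abelian_groupI comm_monoidI)
  let ?R = "cauchy_ring (\<lambda>x. \<bar>\<tau> x\<bar>)"
  fix X assume X: "X \<in> carrier ?R"
  have "(\<lambda>n. - X n) \<in> carrier ?R"
    using X by (simp add: cauchy_ring_def cauchy_seqs_iff_convergent t.hom_uminus convergent_minus_iff[symmetric])
  then show "\<exists>Y\<in>carrier ?R. Y \<oplus>\<^bsub>?R\<^esub> X = \<zero>\<^bsub>?R\<^esub>"
    by (rule bexI[rotated]) (simp add: cauchy_ring_def)
qed (auto simp: cauchy_ring_def cauchy_seqs_iff_convergent t.hom_add t.hom_mult convergent_add convergent_mult
    convergent_const algebra_simps)

lemma ring_hom_limit:
  "ring_hom_ring (cauchy_ring (\<lambda>x. \<bar>\<tau> x\<bar>)) real_ring (\<lambda>X. lim (\<lambda>n. \<tau> (X n)))"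
proof (rule ring_hom_ringI)
  show "ring (cauchy_ring (\<lambda>x. \<bar>\<tau> x\<bar>))" using cring_cauchy_ring by (rule cring.axioms)
  show "ring real_ring" using field_real_ring by (simp add: field_def domain_def cring_def)
  fix X Y assume "X \<in> carrier (cauchy_ring (\<lambda>x. \<bar>\<tau> x\<bar>))" "Y \<in> carrier (cauchy_ring (\<lambda>x. \<bar>\<tau> x\<bar>))"
  then have XY: "(\<lambda>n. \<tau> (X n)) \<longlonglongrightarrow> lim (\<lambda>n. \<tau> (X n))" "(\<lambda>n. \<tau> (Y n)) \<longlonglongrightarrow> lim (\<lambda>n. \<tau> (Y n))"
    by (simp_all add: cauchy_ring_def cauchy_seqs_iff_convergent convergent_LIMSEQ_iff)
  show "lim (\<lambda>n. \<tau> ((X \<otimes>\<^bsub>cauchy_ring (\<lambda>x. \<bar>\<tau> x\<bar>)\<^esub> Y) n)) =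
      lim (\<lambda>n. \<tau> (X n)) \<otimes>\<^bsub>real_ring\<^esub> lim (\<lambda>n. \<tau> (Y n))"
    using limI[OF tendsto_mult[OF XY]] by (simp add: cauchy_ring_def real_ring_def t.hom_mult)
  show "lim (\<lambda>n. \<tau> ((X \<oplus>\<^bsub>cauchy_ring (\<lambda>x. \<bar>\<tau> x\<bar>)\<^esub> Y) n)) =
      lim (\<lambda>n. \<tau> (X n)) \<oplus>\<^bsub>real_ring\<^esub> lim (\<lambda>n. \<tau> (Y n))"
    using limI[OF tendsto_add[OF XY]] by (simp add: cauchy_ring_def real_ring_def t.hom_add)
qed (simp_all add: cauchy_ring_def real_ring_def)

lemma limit_kernel:
  "a_kernel (cauchy_ring (\<lambda>x. \<bar>\<tau> x\<bar>)) real_ring (\<lambda>X. lim (\<lambda>n. \<tau> (X n))) = null_seqs (\<lambda>x. \<bar>\<tau> x\<bar>)"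
proof (rule Set.set_eqI)
  fix X
  have "X \<in> null_seqs (\<lambda>x. \<bar>\<tau> x\<bar>) \<longleftrightarrow> (\<lambda>n. \<tau> (X n)) \<longlonglongrightarrow> 0"
    by (simp add: null_seqs_def tendsto_rabs_zero_iff)
  moreover have "(\<lambda>n. \<tau> (X n)) \<longlonglongrightarrow> 0 \<longleftrightarrow> convergent (\<lambda>n. \<tau> (X n)) \<and> lim (\<lambda>n. \<tau> (X n)) = 0"
  proof
    assume lim: "(\<lambda>n. \<tau> (X n)) \<longlonglongrightarrow> 0"
    show "convergent (\<lambda>n. \<tau> (X n)) \<and> lim (\<lambda>n. \<tau> (X n)) = 0"
      using convergentI[OF lim] limI[OF lim] by (rule conjI)
  next
    assume "convergent (\<lambda>n. \<tau> (X n)) \<and> lim (\<lambda>n. \<tau> (X n)) = 0"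
    then show "(\<lambda>n. \<tau> (X n)) \<longlonglongrightarrow> 0" by (elim conjE) (simp add: convergent_LIMSEQ_iff)
  qed
  ultimately show "X \<in> a_kernel (cauchy_ring (\<lambda>x. \<bar>\<tau> x\<bar>)) real_ring (\<lambda>X. lim (\<lambda>n. \<tau> (X n))) \<longleftrightarrow>
      X \<in> null_seqs (\<lambda>x. \<bar>\<tau> x\<bar>)"
    by (simp add: a_kernel_def' cauchy_ring_def real_ring_def cauchy_seqs_iff_convergent)
qed

lemma rational_approximation:
  obtains q :: "nat \<Rightarrow> rat" where "(\<lambda>n. of_rat (q n)) \<longlonglongrightarrow> (r :: real)"
proof -
  have "\<exists>q :: rat. \<bar>of_rat q - r\<bar> < inverse (real (Suc n))" for n
  proof -
    obtain s where s: "s \<in> \<rat>" "r < s" "s < r + inverse (real (Suc n))"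
      using Rats_dense_in_real[of r "r + inverse (real (Suc n))"] by auto
    obtain q where "s = of_rat q" using s(1) by (rule Rats_cases)
    with s show ?thesis by (intro exI[of _ q]) simp
  qed
  then obtain q :: "nat \<Rightarrow> rat" where q: "\<And>n. \<bar>of_rat (q n) - r\<bar> < inverse (real (Suc n))" by metis
  have "(\<lambda>n. of_rat (q n) - r) \<longlonglongrightarrow> 0"
    by (rule null_seq_dominated[OF less_imp_le[OF q] LIMSEQ_inverse_real_of_nat])
  then show thesis by (intro that) (rule LIM_zero_cancel)
qed

text \<open>
  Every real number is a limit of rational numbers, so the classes of rational Cauchy sequences
  already exhaust the completion, which has dimension 1 over itself.
\<close>

lemma local_degree_real_place: "local_degree (\<lambda>x. \<bar>\<tau> x\<bar>) = 1"
proof -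
  let ?v = "\<lambda>x. \<bar>\<tau> x\<bar>"
  let ?h = "\<lambda>X. lim (\<lambda>n. \<tau> (X n))"
  interpret h: ring_hom_ring "cauchy_ring ?v" real_ring ?h by (rule ring_hom_limit)
  interpret RR: field real_ring by (rule field_real_ring)
  have approx: "\<exists>Y. Y \<in> cauchy_seqs ?v \<and> range Y \<subseteq> \<rat> \<and> ?h Y = r" for r
  proof -
    obtain q :: "nat \<Rightarrow> rat" where q: "(\<lambda>n. of_rat (q n)) \<longlonglongrightarrow> r" by (rule rational_approximation)
    have eq: "(\<lambda>n. \<tau> (of_rat (q n))) = (\<lambda>n. of_rat (q n))" by (simp add: field_hom_of_rat[OF \<tau>])
    show ?thesis
    proof (intro exI[of _ "\<lambda>n. of_rat (q n)"] conjI)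
      show "(\<lambda>n. of_rat (q n)) \<in> cauchy_seqs ?v"
        unfolding cauchy_seqs_iff_convergent eq using q by (rule convergentI)
      show "lim (\<lambda>n. \<tau> (of_rat (q n))) = r" unfolding eq using q by (rule limI)
    qed auto
  qed
  have compl: "completion ?v = cauchy_ring ?v Quot a_kernel (cauchy_ring ?v) real_ring ?h"
    by (simp only: completion_def limit_kernel)
  have "?h ` carrier (cauchy_ring ?v) = carrier real_ring"
  proof -
    have "r \<in> ?h ` carrier (cauchy_ring ?v)" for r
      using approx[of r] by (auto simp: cauchy_ring_def)
    then show ?thesis by (auto simp: real_ring_def)
  qed
  from h.FactRing_iso_set[OF this]
  have iso: "(\<lambda>X. the_elem (?h ` X)) \<in> ring_iso (completion ?v) real_ring" unfolding compl .
  have ring: "ring (completion ?v)"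
    unfolding compl by (intro ideal.quotient_is_ring h.kernel_is_ideal)
  define g where "g = inv_into (carrier (completion ?v)) (\<lambda>X. the_elem (?h ` X))"
  have g: "g \<in> ring_iso real_ring (completion ?v)"
    unfolding g_def by (rule ring_iso_set_sym[OF ring iso])
  then have "g \<zero>\<^bsub>real_ring\<^esub> = \<zero>\<^bsub>completion ?v\<^esub>"
    using ring_hom_zero[OF _ h.S.ring_axioms ring] by (simp add: ring_iso_def)
  then have "field (completion ?v)" using RR.ring_iso_imp_img_field[OF g] by simp
  then interpret C: field "completion ?v" .
  have "rat_completion ?v = carrier (completion ?v)"
  proof (intro equalityI subsetI)
    fix Z assume "Z \<in> rat_completion ?v"
    then show "Z \<in> carrier (completion ?v)"
      by (auto simp: rat_completion_def completion_def FactRing_def A_RCOSETS_def' cauchy_ring_def)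
  next
    fix Z assume "Z \<in> carrier (completion ?v)"
    then obtain X where X: "X \<in> carrier (cauchy_ring ?v)" "Z = null_seqs ?v +>\<^bsub>cauchy_ring ?v\<^esub> X"
      by (auto simp: completion_def FactRing_def A_RCOSETS_def')
    obtain Y where Y: "Y \<in> cauchy_seqs ?v" "range Y \<subseteq> \<rat>" "?h Y = ?h X" using approx by blast
    then have "Y \<in> carrier (cauchy_ring ?v)" by (simp add: cauchy_ring_def)
    then have "null_seqs ?v +>\<^bsub>cauchy_ring ?v\<^esub> X = null_seqs ?v +>\<^bsub>cauchy_ring ?v\<^esub> Y"
      using h.rcos_eq_homeq[OF X(1)] h.rcos_eq_homeq[of Y] Y(3) unfolding limit_kernel by simp
    with X Y show "Z \<in> rat_completion ?v" unfolding rat_completion_def by blast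
  qed
  then show ?thesis
    unfolding local_degree_def
    using C.dimension_one[OF C.carrier_is_subfield] C.dimension_is_inj[OF C.carrier_is_subfield]
    by (intro the_equality) auto
qed

end


section \<open>The height of totally real algebraic integers\<close>

abbreviation real_embeddings :: "('k::field_char_0 \<Rightarrow> real) set" where
  "real_embeddings \<equiv> {\<tau>. field_hom \<tau>}"

lemma real_place_absolute_value:
  assumes "field_hom (\<tau> :: 'k::field_char_0 \<Rightarrow> real)"
  shows "absolute_value (\<lambda>x. \<bar>\<tau> x\<bar>)"
proof -
  interpret t: field_hom \<tau> by fact
  have "\<tau> x = 0 \<longleftrightarrow> x = 0" for x
    using t.hom_mult[of x "inverse x"] by (cases "x = 0") (auto simp: t.hom_one t.hom_zero)
  then show ?thesis
    by (simp add: absolute_value_def t.hom_mult t.hom_add abs_mult abs_triangle_ineq)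
qed

text \<open>
  Adding a large integer to \<open>x\<close> makes both values positive, so the absolute values determine them.
\<close>

lemma real_place_inj: "inj_on (\<lambda>\<tau> x. \<bar>\<tau> x\<bar>) (real_embeddings :: ('k::field_char_0 \<Rightarrow> real) set)"
proof (rule inj_onI, rule ext)
  fix \<sigma> \<tau> :: "'k \<Rightarrow> real" and x
  assume "\<sigma> \<in> real_embeddings" "\<tau> \<in> real_embeddings" and eq: "(\<lambda>x. \<bar>\<sigma> x\<bar>) = (\<lambda>x. \<bar>\<tau> x\<bar>)"
  then interpret s: field_hom \<sigma> + t: field_hom \<tau> by simp_all
  obtain m :: nat where m: "\<bar>\<sigma> x\<bar> + \<bar>\<tau> x\<bar> < of_nat m" using reals_Archimedean2 by blast
  have "\<bar>\<sigma> (x + of_nat m)\<bar> = \<bar>\<tau> (x + of_nat m)\<bar>" using fun_cong[OF eq] .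
  then have "\<bar>\<sigma> x + of_nat m\<bar> = \<bar>\<tau> x + of_nat m\<bar>"
    by (simp only: s.hom_add t.hom_add s.hom_of_nat t.hom_of_nat)
  with m show "\<sigma> x = \<tau> x" by linarith
qed

lemma real_embeddings_card:
  assumes nf: "number_field TYPE('k::field_char_0)" and tr: "totally_real TYPE('k)"
  shows "bij_betw (\<lambda>\<tau> x. complex_of_real (\<tau> x)) (real_embeddings :: ('k \<Rightarrow> real) set) {\<sigma>. field_hom \<sigma>}"
    and "finite (real_embeddings :: ('k \<Rightarrow> real) set)"
    and "card (real_embeddings :: ('k \<Rightarrow> real) set) = field_degree TYPE('k)"
proof -
  show bij: "bij_betw (\<lambda>\<tau> x. complex_of_real (\<tau> x)) (real_embeddings :: ('k \<Rightarrow> real) set) {\<sigma>. field_hom \<sigma>}"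
  proof (rule bij_betw_byWitness[where f' = "\<lambda>\<sigma> x. Re (\<sigma> x)"])
    have real: "complex_of_real (Re (\<sigma> x)) = \<sigma> x" if "field_hom \<sigma>" for \<sigma> :: "'k \<Rightarrow> complex" and x
    proof -
      have "range \<sigma> \<subseteq> \<real>" using tr that unfolding totally_real_def by simp
      then have "\<sigma> x \<in> \<real>" by (rule subsetD[OF _ rangeI])
      then show ?thesis by simp
    qed
    then show "\<forall>\<sigma>\<in>{\<sigma> :: 'k \<Rightarrow> complex. field_hom \<sigma>}. (\<lambda>x. complex_of_real (Re (\<sigma> x))) = \<sigma>"
      by auto
    show "(\<lambda>\<tau> x. complex_of_real (\<tau> x)) ` (real_embeddings :: ('k \<Rightarrow> real) set) \<subseteq> {\<sigma>. field_hom \<sigma>}"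
    proof (rule image_subsetI)
      fix \<tau> :: "'k \<Rightarrow> real" assume "\<tau> \<in> real_embeddings"
      then interpret t: field_hom \<tau> by simp
      show "(\<lambda>x. complex_of_real (\<tau> x)) \<in> {\<sigma>. field_hom \<sigma>}"
        by (intro CollectI field_homI) (simp_all add: t.hom_add t.hom_mult)
    qed
    show "(\<lambda>\<sigma> x. Re (\<sigma> x)) ` {\<sigma> :: 'k \<Rightarrow> complex. field_hom \<sigma>} \<subseteq> real_embeddings"
    proof (rule image_subsetI)
      fix \<sigma> :: "'k \<Rightarrow> complex" assume "\<sigma> \<in> {\<sigma>. field_hom \<sigma>}"
      then have \<sigma>: "field_hom \<sigma>" by simp
      interpret s: field_hom \<sigma> by (rule \<sigma>)
      have "Im (\<sigma> x) = 0" for x using real[OF \<sigma>, of x] by (simp add: complex_eq_iff)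
      then show "(\<lambda>x. Re (\<sigma> x)) \<in> real_embeddings"
        by (intro CollectI field_homI) (simp_all add: s.hom_add s.hom_mult)
    qed
  qed auto
  show "finite (real_embeddings :: ('k \<Rightarrow> real) set)"
    using bij_betw_finite[OF bij] field_homs_card(1)[OF nf] by simp
  show "card (real_embeddings :: ('k \<Rightarrow> real) set) = field_degree TYPE('k)"
    using bij_betw_same_card[OF bij] field_homs_card(2)[OF nf] by simp
qed

text \<open>
  Places over a prime contribute 1 for algebraic integers, and the remaining places correspond to the
  real embeddings with local degree 1.
\<close>

theorem height_totally_real_integers:
  fixes \<gamma> :: "'k::field_char_0 list"
  assumes nf: "number_field TYPE('k)" and tr: "totally_real TYPE('k)"
    and \<gamma>: "set \<gamma> \<subseteq> ring_of_integers"
  shows "height \<gamma> = (\<Prod>\<tau>\<in>real_embeddings. Max (insert 1 ((\<lambda>x. \<bar>\<tau> x\<bar>) ` set \<gamma>)))"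
proof -
  let ?L = "\<lambda>\<tau> :: 'k \<Rightarrow> real. local_height (\<lambda>x. \<bar>\<tau> x\<bar>) \<gamma>"
  let ?R = "real_embeddings :: ('k \<Rightarrow> real) set"
  have "{v \<in> places. local_height v \<gamma> \<noteq> 1} = (\<lambda>\<tau> x. \<bar>\<tau> x\<bar>) ` {\<tau> \<in> ?R. ?L \<tau> \<noteq> 1}" (is "?A = ?B")
  proof (intro equalityI subsetI)
    fix v assume "v \<in> ?A"
    then have v: "absolute_value v" "local_height v \<gamma> \<noteq> 1"
      "(\<forall>q. v (of_rat q) = \<bar>of_rat q\<bar>) \<or> (\<exists>p. prime p \<and> (\<forall>q. v (of_rat q) = padic_abs p q))"
      unfolding places_def by simp_all
    have "\<forall>q. v (of_rat q) = \<bar>of_rat q\<bar>"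
      using v(3)
    proof
      assume "\<exists>p. prime p \<and> (\<forall>q. v (of_rat q) = padic_abs p q)"
      then obtain p where "prime p" "\<forall>q. v (of_rat q) = padic_abs p q" by (elim exE conjE)
      then have "local_height v \<gamma> = 1"
        using local_height_nonarchimedean[OF v(1) _ _ \<gamma>] by simp
      with v(2) show ?thesis by simp
    qed
    then obtain \<tau> :: "'k \<Rightarrow> real" where \<tau>: "field_hom \<tau>" "v = (\<lambda>x. \<bar>\<tau> x\<bar>)"
      using archimedean_place_embedding[OF nf tr v(1)] by auto
    then show "v \<in> ?B" using v(2) by (intro image_eqI[of _ _ \<tau>]) simp_all
  next
    fix v assume "v \<in> ?B"
    then obtain \<tau> :: "'k \<Rightarrow> real" where \<tau>: "field_hom \<tau>" "v = (\<lambda>x. \<bar>\<tau> x\<bar>)" "?L \<tau> \<noteq> 1" by auto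
    then show "v \<in> ?A"
      by (simp add: places_def real_place_absolute_value field_hom_of_rat)
  qed
  then have "height \<gamma> = prod (\<lambda>v. local_height v \<gamma>) ((\<lambda>\<tau> x. \<bar>\<tau> x\<bar>) ` {\<tau> \<in> ?R. ?L \<tau> \<noteq> 1})"
    by (simp only: height_def)
  also have "\<dots> = (\<Prod>\<tau>\<in>{\<tau> \<in> ?R. ?L \<tau> \<noteq> 1}. ?L \<tau>)"
    by (subst prod.reindex) (auto intro: inj_on_subset[OF real_place_inj] simp: o_def)
  also have "\<dots> = (\<Prod>\<tau>\<in>?R. ?L \<tau>)"
    using real_embeddings_card(2)[OF nf tr] by (intro prod.mono_neutral_left) auto
  also have "\<dots> = (\<Prod>\<tau>\<in>?R. Max (insert 1 ((\<lambda>x. \<bar>\<tau> x\<bar>) ` set \<gamma>)))"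
    by (intro prod.cong refl) (simp add: local_height_def local_degree_real_place)
  finally show ?thesis .
qed

section \<open>Norms of algebraic integers\<close>

lemma common_integral_multiple:
  assumes nf: "number_field TYPE('k::field_char_0)" and O: "ring_of_integers = Z.span (A :: 'k set)"
    and "finite P"
  shows "\<exists>N :: int. N \<noteq> 0 \<and> (\<forall>y\<in>P. of_int N * y \<in> (ring_of_integers :: 'k set))"
  using assms(3)
proof (induction P rule: finite_induct)
  case empty
  then show ?case by (intro exI[of _ 1]) simp
next
  case (insert a P)
  then obtain N :: int where N: "N \<noteq> 0" "\<forall>y\<in>P. of_int N * y \<in> ring_of_integers" by blast
  obtain m :: int where m: "m \<noteq> 0" "of_int m * a \<in> ring_of_integers"
    using integral_multiple[OF nf, of a] by (auto simp: ring_of_integers_def)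
  have "of_int (m * N) * y \<in> ring_of_integers" if "y \<in> insert a P" for y
  proof -
    have scale: "of_int c * w \<in> ring_of_integers" if "w \<in> ring_of_integers" for c :: int and w :: 'k
      using that unfolding O by (rule Z.span_scale)
    show ?thesis
    proof (cases "y = a")
      case True
      then show ?thesis using scale[OF m(2), of N] by (simp add: mult_ac)
    next
      case False
      with that N(2) have "of_int N * y \<in> ring_of_integers" by blast
      from scale[OF this, of m] show ?thesis by (simp add: mult_ac)
    qed
  qed
  moreover have "m * N \<noteq> 0" using m N by simp
  ultimately show ?case by blast
qed

lemma det_scale_rows:
  fixes B :: "complex mat"
  assumes B: "B \<in> carrier_mat d d"
  shows "det (mat d d (\<lambda>(i, j). f i * B $$ (i, j))) = (\<Prod>i<d. f i) * det B"
proof -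
  let ?A = "mat d d (\<lambda>(i, j). f i * B $$ (i, j))"
  have perm_prod: "(\<Prod>i = 0..<d. ?A $$ (i, p i)) = (\<Prod>i<d. f i) * (\<Prod>i = 0..<d. B $$ (i, p i))"
    if p: "p permutes {0..<d}" for p
  proof -
    have "p i < d" if "i < d" for i using permutes_in_image[OF p, of i] that by simp
    then have "(\<Prod>i = 0..<d. ?A $$ (i, p i)) = (\<Prod>i = 0..<d. f i * B $$ (i, p i))"
      by (intro prod.cong) auto
    then show ?thesis by (simp add: prod.distrib atLeast0LessThan)
  qed
  have "det ?A = (\<Sum>p\<in>{p. p permutes {0..<d}}.
      signof p * ((\<Prod>i<d. f i) * (\<Prod>i = 0..<d. B $$ (i, p i))))"
    unfolding det_def'[of ?A d, OF mat_carrier]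
    by (rule sum.cong[OF refl]) (simp only: perm_prod mem_Collect_eq)
  then show ?thesis
    unfolding det_def'[OF B] sum_distrib_left by (simp only: mult.left_commute)
qed

text \<open>
  The powers of \<open>x\<close> have a common denominator \<open>N\<close> relative to an integral basis: \<open>N x\<^sup>k \<omega>\<^sub>j\<close> is
  an algebraic integer for all \<open>k\<close> and \<open>j\<close>, because \<open>x\<^sup>k\<close> is an integral combination of finitely many
  powers.  So multiplication by \<open>N x\<^sup>k\<close> has an integral matrix with nonzero determinant, of absolute
  value \<open>\<bar>N\<bar>\<^sup>d\<close> times the \<open>k\<close>-th power of the norm.  A norm below 1 contradicts this for
  large \<open>k\<close>.
\<close>

theorem norm_algebraic_int_ge_1:
  fixes x :: "'k::field_char_0"
  assumes nf: "number_field TYPE('k)" and A: "finite A" "ring_of_integers = Z.span (A :: 'k set)"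
    and x: "algebraic_int x" "x \<noteq> 0"
  shows "1 \<le> (\<Prod>\<sigma>\<in>{\<sigma> :: 'k \<Rightarrow> complex. field_hom \<sigma>}. cmod (\<sigma> x))"
proof (rule ccontr)
  let ?E = "{\<sigma> :: 'k \<Rightarrow> complex. field_hom \<sigma>}"
  let ?norm = "\<Prod>\<sigma>\<in>?E. cmod (\<sigma> x)"
  assume less: "\<not> 1 \<le> ?norm"
  define d where "d = field_degree TYPE('k)"
  obtain \<sigma> where \<sigma>: "set \<sigma> = ?E" "distinct \<sigma>"
    using finite_distinct_list[OF field_homs_card(1)[OF nf]] by blast
  then have emb: "embedding_list \<sigma>" by (simp add: embedding_list_def)
  have len\<sigma>: "length \<sigma> = d" using \<sigma> field_homs_card(2)[OF nf] d_def by (metis distinct_card)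
  obtain \<omega> :: "'k list" where \<omega>: "integral_basis \<omega>" using exists_integral_basis[OF A] by blast
  note \<omega>_basis = integral_basis_rat_basis[OF nf \<omega>]
  let ?L = "mat d d (\<lambda>(i, j). (\<sigma> ! i) (\<omega> ! j))"
  have det: "det ?L \<noteq> 0" by (rule embedding_det_nonzero[OF nf emb \<omega>_basis(2,1) d_def])
  obtain n where pow: "\<And>k. x ^ k \<in> Z.span ((\<lambda>i. x ^ i) ` {..<n})"
    using algebraic_int_powers_in_span[OF x(1)] by blast
  define P where "P = (\<lambda>(i, j). x ^ i * \<omega> ! j) ` ({..<n} \<times> {..<d})"
  have "finite P" by (simp add: P_def)
  from common_integral_multiple[OF nf A(2) this]
  obtain N :: int where N: "N \<noteq> 0" "\<forall>y\<in>P. of_int N * y \<in> ring_of_integers" by blast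
  have int: "of_int N * (x ^ k * \<omega> ! j) \<in> ring_of_integers" if "j < d" for k j
  proof -
    have "of_int N * (y * \<omega> ! j) \<in> ring_of_integers" if "y \<in> Z.span ((\<lambda>i. x ^ i) ` {..<n})" for y
      using that
    proof (induction rule: Z.span_induct_alt)
      case base
      then show ?case by (simp add: A(2) Z.span_zero)
    next
      case (step c b z)
      then have "b * \<omega> ! j \<in> P" using \<open>j < d\<close> by (auto simp: P_def)
      with N(2) have b: "of_int N * (b * \<omega> ! j) \<in> ring_of_integers" by blast
      have "of_int c * (of_int N * (b * \<omega> ! j)) + of_int N * (z * \<omega> ! j) \<in> ring_of_integers"
        using Z.span_add[OF Z.span_scale[OF b[unfolded A(2)], of c] step.IH[unfolded A(2)]]
        unfolding A(2) .
      moreover have "of_int c * (of_int N * (b * \<omega> ! j)) + of_int N * (z * \<omega> ! j) =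
          of_int N * ((of_int c * b + z) * \<omega> ! j)"
        by (simp only: distrib_left distrib_right mult.assoc mult.left_commute)
      ultimately show ?case by (simp only:)
    qed
    from this[OF pow] show ?thesis .
  qed
  have bound: "1 \<le> \<bar>of_int N\<bar> ^ d * ?norm ^ k" for k
  proof -
    have "\<exists>c :: int list. of_int N * (x ^ k * \<omega> ! j) = (\<Sum>l<d. of_int (c ! l) * \<omega> ! l)" if "j < d" for j
      using int[OF that, of k] \<omega> unfolding integral_basis_def bij_betw_def \<omega>_basis(2) d_def[symmetric] by blast
    then obtain C :: "nat \<Rightarrow> int list" where
      C: "\<And>j. j < d \<Longrightarrow> of_int N * (x ^ k * \<omega> ! j) = (\<Sum>l<d. of_int (C j ! l) * \<omega> ! l)" by metis
    define CM where "CM = mat d d (\<lambda>(l, j). C j ! l)"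
    let ?f = "\<lambda>i. of_int N * (\<sigma> ! i) x ^ k"
    have "mat d d (\<lambda>(i, j). ?f i * ?L $$ (i, j)) = ?L * map_mat of_int CM"
    proof (rule eq_matI)
      fix i j assume "i < dim_row (?L * map_mat of_int CM)" "j < dim_col (?L * map_mat of_int CM)"
      then have ij: "i < d" "j < d" by (auto simp: CM_def)
      have "\<sigma> ! i \<in> set \<sigma>" using ij len\<sigma> by simp
      then interpret h: field_hom "\<sigma> ! i" using \<sigma>(1) by simp
      have "?f i * (\<sigma> ! i) (\<omega> ! j) = (\<sigma> ! i) (of_int N * (x ^ k * \<omega> ! j))"
        by (simp add: h.hom_mult h.hom_of_int h.hom_power)
      also have "\<dots> = (\<Sum>l<d. of_int (C j ! l) * (\<sigma> ! i) (\<omega> ! l))"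
        unfolding C[OF ij(2)] by (simp add: h.hom_sum h.hom_mult h.hom_of_int)
      finally show "mat d d (\<lambda>(i, j). ?f i * ?L $$ (i, j)) $$ (i, j) = (?L * map_mat of_int CM) $$ (i, j)"
        using ij by (simp add: CM_def scalar_prod_def lessThan_atLeast0 mult.commute)
    qed (auto simp: CM_def)
    then have "det (mat d d (\<lambda>(i, j). ?f i * ?L $$ (i, j))) = det ?L * of_int (det CM)"
      by (simp add: det_mult[of _ d] CM_def)
    then have eq: "(\<Prod>i<d. ?f i) = of_int (det CM)"
      using det by (simp add: det_scale_rows[of ?L d])
    have "cmod (\<Prod>i<d. ?f i) = (\<Prod>i<d. \<bar>of_int N\<bar> * cmod ((\<sigma> ! i) x) ^ k)"
      by (simp add: prod_norm[symmetric] norm_mult norm_power)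
    also have "\<dots> = \<bar>of_int N\<bar> ^ d * (\<Prod>i<d. cmod ((\<sigma> ! i) x)) ^ k"
      by (simp add: prod.distrib prod_power_distrib)
    also have "(\<Prod>i<d. cmod ((\<sigma> ! i) x)) = (\<Prod>\<tau>\<in>set \<sigma>. cmod (\<tau> x))"
      by (rule prod.reindex_bij_betw) (use \<sigma>(2) len\<sigma> in \<open>auto intro: bij_betw_nth\<close>)
    finally have norm: "cmod (of_int (det CM)) = \<bar>of_int N\<bar> ^ d * ?norm ^ k"
      unfolding eq \<sigma>(1) .
    have "?f i \<noteq> 0" if "i < d" for i
    proof -
      have "\<sigma> ! i \<in> set \<sigma>" using that len\<sigma> by simp
      then interpret h: field_hom "\<sigma> ! i" using \<sigma>(1) by simp
      have "(\<sigma> ! i) x * (\<sigma> ! i) (inverse x) = 1"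
        using x(2) by (simp add: h.hom_mult[symmetric] h.hom_one)
      then show ?thesis using N(1) by auto
    qed
    then have "det CM \<noteq> 0" using eq by auto
    then have "1 \<le> cmod (of_int (det CM))" by simp
    then show ?thesis unfolding norm .
  qed
  have "0 \<le> ?norm" by (intro prod_nonneg) simp
  moreover have "(0 :: real) < 1 / \<bar>of_int N\<bar> ^ d" using N(1) by simp
  ultimately obtain k where k: "?norm ^ k < 1 / \<bar>of_int N\<bar> ^ d"
    using real_arch_pow_inv[of "1 / \<bar>of_int N\<bar> ^ d" ?norm] less by auto
  have "(0 :: real) < \<bar>of_int N\<bar> ^ d" using N(1) by simp
  with k have "\<bar>of_int N\<bar> ^ d * ?norm ^ k < 1" by (simp add: pos_less_divide_eq mult.commute)
  with bound[of k] show False by simp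
qed

section \<open>Counting representations\<close>

lemma card_bounded_lists:
  "card {x :: nat list. length x = n \<and> (\<forall>i<n. x ! i < m)} = m ^ n"
  and finite_bounded_lists: "finite {x :: nat list. length x = n \<and> (\<forall>i<n. x ! i < m)}"
proof -
  have eq: "{x :: nat list. length x = n \<and> (\<forall>i<n. x ! i < m)} = {x. set x \<subseteq> {..<m} \<and> length x = n}"
    by (auto simp: set_conv_nth)
  show "card {x :: nat list. length x = n \<and> (\<forall>i<n. x ! i < m)} = m ^ n"
    unfolding eq by (simp add: card_lists_length_eq)
  show "finite {x :: nat list. length x = n \<and> (\<forall>i<n. x ! i < m)}"
    unfolding eq by (simp add: finite_lists_length_eq)
qed

text \<open>
  The generators are nonzero and totally nonnegative, so all \<open>\<tau> (\<alpha> ! i)\<close> are positive; more generators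
  than the degree means at least two of them.
\<close>

locale totally_real_generators =
  fixes \<alpha> :: "'k::field_char_0 list"
  assumes nf: "number_field TYPE('k)" and tr: "totally_real TYPE('k)"
    and \<alpha>: "\<And>a. a \<in> set \<alpha> \<Longrightarrow> a \<noteq> 0 \<and> a \<in> nonneg_integers"
    and span: "ring_of_integers = Z.span (set \<alpha>)"
    and many: "field_degree TYPE('k) < length \<alpha>"
begin

definition d where "d = field_degree TYPE('k)"
definition n where "n = length \<alpha>"
definition combination where "combination x = (\<Sum>i<length \<alpha>. \<alpha> ! i * of_nat (x ! i))" for x :: "nat list"
definition M :: "('k \<Rightarrow> real) \<Rightarrow> real" where "M \<tau> = Max (insert 1 ((\<lambda>x. \<bar>\<tau> x\<bar>) ` set \<alpha>))"

lemmas fin = real_embeddings_card(2)[OF nf tr]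

lemma card_embeddings: "card (real_embeddings :: ('k \<Rightarrow> real) set) = d"
  using real_embeddings_card(3)[OF nf tr] by (simp add: d_def)

lemma d_pos: "d > 0"
proof -
  obtain B :: "'k set" where B: "finite B" "Q.independent B" "Q.span B = UNIV"
    and card: "card B = field_degree TYPE('k)" by (rule number_field_basis[OF nf])
  have "B \<noteq> {}"
  proof
    assume "B = {}"
    then have "(1 :: 'k) \<in> {0}" using B(3) by simp
    then show False by simp
  qed
  with B(1) card show ?thesis by (simp add: d_def card_gt_0_iff flip: card)
qed

lemma n_pos: "n > 0" and n_gt: "d < n" using many by (auto simp: n_def d_def)

lemma set_\<alpha>_integral: "set \<alpha> \<subseteq> ring_of_integers"
  using \<alpha> by (auto simp: nonneg_integers_def)

lemma M_ge_1: "1 \<le> M \<tau>" by (simp add: M_def)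

lemma M_pos: "0 < M \<tau>" using M_ge_1[of \<tau>] by linarith

lemma le_M: "a \<in> set \<alpha> \<Longrightarrow> \<bar>\<tau> a\<bar> \<le> M \<tau>" by (simp add: M_def)

lemma height_\<alpha>: "height \<alpha> = (\<Prod>\<tau>\<in>real_embeddings. M \<tau>)"
  unfolding M_def by (rule height_totally_real_integers[OF nf tr set_\<alpha>_integral])

lemma embedding_combination:
  assumes "\<tau> \<in> real_embeddings"
  shows "\<tau> (combination x) = (\<Sum>i<n. \<tau> (\<alpha> ! i) * of_nat (x ! i))"
proof -
  interpret t: field_hom \<tau> using assms by simp
  show ?thesis by (simp add: combination_def n_def t.hom_sum t.hom_mult t.hom_of_nat)
qed

lemma embedding_\<alpha>_pos:
  assumes \<tau>: "\<tau> \<in> real_embeddings" and i: "i < n"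
  shows "0 < \<tau> (\<alpha> ! i)"
proof -
  interpret t: field_hom \<tau> using \<tau> by simp
  have a: "\<alpha> ! i \<noteq> 0" "\<alpha> ! i \<in> nonneg_integers" using \<alpha>[of "\<alpha> ! i"] i by (auto simp: n_def)
  have "\<tau> (\<alpha> ! i) * \<tau> (inverse (\<alpha> ! i)) = 1"
    using a by (simp add: t.hom_mult[symmetric] t.hom_one)
  then have ne: "0 \<noteq> \<tau> (\<alpha> ! i)" by auto
  have "0 \<le> \<tau> (\<alpha> ! i)" using a(2) \<tau> by (simp add: nonneg_integers_def)
  then show ?thesis using ne by (rule order_le_neq_trans)
qed

lemma combination_integral: "combination x \<in> ring_of_integers"
proof -
  have "of_int (int (x ! i)) * \<alpha> ! i \<in> Z.span (set \<alpha>)" if "i < length \<alpha>" for i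
    using that by (intro Z.span_scale Z.span_base) simp
  then have "\<alpha> ! i * of_nat (x ! i) \<in> Z.span (set \<alpha>)" if "i < length \<alpha>" for i
    using that by (simp add: mult.commute)
  then show ?thesis unfolding combination_def span by (intro Z.span_sum) simp
qed

lemma embedding_combination_nonneg: "\<tau> \<in> real_embeddings \<Longrightarrow> 0 \<le> \<tau> (combination x)"
  unfolding embedding_combination using embedding_\<alpha>_pos by (intro sum_nonneg) (simp add: less_imp_le)

lemma height_combination: "height [combination x] = (\<Prod>\<tau>\<in>real_embeddings. max 1 (\<tau> (combination x)))"
proof -
  have "height [combination x] = (\<Prod>\<tau>\<in>real_embeddings. max 1 \<bar>\<tau> (combination x)\<bar>)"
    using height_totally_real_integers[OF nf tr, of "[combination x]"] combination_integral by simp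
  also have "\<dots> = (\<Prod>\<tau>\<in>real_embeddings. max 1 (\<tau> (combination x)))"
    by (intro prod.cong refl) (simp only: abs_of_nonneg[OF embedding_combination_nonneg])
  finally show ?thesis .
qed

lemma height_combination_ge_1: "1 \<le> height [combination x]"
  unfolding height_combination by (intro prod_ge_1) simp

text \<open>
  Each \<open>\<tau> (\<alpha> ! i) * x ! i\<close> is at most \<open>\<tau>\<close> of the whole combination, as all summands are nonnegative.  The
  product of these inequalities loses nothing on the left because the norm of \<open>\<alpha> ! i\<close> is at
  least 1.
\<close>

lemma entry_le_height:
  assumes i: "i < n"
  shows "of_nat (x ! i) \<le> height [combination x]"
proof (cases "x ! i = 0")
  case True
  then show ?thesis using height_combination_ge_1[of x] by simp
next
  case False
  let ?R = "real_embeddings :: ('k \<Rightarrow> real) set"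
  have "\<alpha> ! i \<in> set \<alpha>" using i by (simp add: n_def)
  then have "algebraic_int (\<alpha> ! i)" "\<alpha> ! i \<noteq> 0"
    using \<alpha> by (auto simp: nonneg_integers_def ring_of_integers_def)
  note norm_ge_1 = norm_algebraic_int_ge_1[OF nf finite_set span this]
  have norm: "1 \<le> (\<Prod>\<tau>\<in>?R. \<tau> (\<alpha> ! i))"
  proof -
    have "(\<Prod>\<sigma>\<in>{\<sigma> :: 'k \<Rightarrow> complex. field_hom \<sigma>}. cmod (\<sigma> (\<alpha> ! i))) =
        (\<Prod>\<tau>\<in>?R. cmod (complex_of_real (\<tau> (\<alpha> ! i))))"
      by (rule prod.reindex_bij_betw[OF real_embeddings_card(1)[OF nf tr], symmetric])
    also have "\<dots> = (\<Prod>\<tau>\<in>?R. \<tau> (\<alpha> ! i))"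
      using embedding_\<alpha>_pos[OF _ i] by (intro prod.cong refl) (simp add: less_imp_le)
    finally show ?thesis using norm_ge_1 by simp
  qed
  have "real (x ! i) \<le> real (x ! i) ^ d" using False d_pos by (intro self_le_power) auto
  also have "\<dots> = real (x ! i) ^ d * 1" by simp
  also have "\<dots> \<le> real (x ! i) ^ d * (\<Prod>\<tau>\<in>?R. \<tau> (\<alpha> ! i))"
    by (rule mult_left_mono[OF norm]) simp
  also have "\<dots> = (\<Prod>\<tau>\<in>?R. \<tau> (\<alpha> ! i) * real (x ! i))"
    by (simp add: prod.distrib card_embeddings)
  also have "\<dots> \<le> (\<Prod>\<tau>\<in>?R. max 1 (\<tau> (combination x)))"
  proof (intro prod_mono conjI)
    fix \<tau> assume \<tau>: "\<tau> \<in> ?R"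
    show "0 \<le> \<tau> (\<alpha> ! i) * real (x ! i)" using embedding_\<alpha>_pos[OF \<tau> i] by simp
    have "\<tau> (\<alpha> ! i) * real (x ! i) \<le> \<tau> (combination x)"
      unfolding embedding_combination[OF \<tau>]
      using i embedding_\<alpha>_pos[OF \<tau>] by (intro member_le_sum[of i "{..<n}" "\<lambda>i. \<tau> (\<alpha> ! i) * real (x ! i)"]) (auto simp: less_imp_le)
    then show "\<tau> (\<alpha> ! i) * real (x ! i) \<le> max 1 (\<tau> (combination x))" by simp
  qed
  finally show ?thesis unfolding height_combination .
qed

lemma height_\<alpha>_pos: "0 < height \<alpha>"
  unfolding height_\<alpha> by (rule prod_pos) (rule M_pos)

definition box_size :: "real \<Rightarrow> real" where
  "box_size T = T powr (1 / d) / (n * height \<alpha> powr (1 / d))"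

lemma box_size_nonneg: "0 \<le> box_size T" unfolding box_size_def by simp

text \<open>
  With \<open>t = box_size T\<close>, which is at least 1 as soon as the box is nonempty, every factor \<open>max 1 (\<tau> \<beta>)\<close> of
  the height is below \<open>M \<tau> * n * t\<close>, and \<open>t\<close> is chosen so that the product of these bounds over all
  embeddings is \<open>T\<close>.  The strict inequality lets the box be separated from the solutions of height
  at least \<open>T\<close>.
\<close>

lemma height_box:
  assumes T: "0 \<le> T" and x: "\<And>i. i < n \<Longrightarrow> x ! i < nat \<lfloor>box_size T\<rfloor>"
  shows "height [combination x] < T"
proof -
  let ?R = "real_embeddings :: ('k \<Rightarrow> real) set"
  let ?t = "box_size T"
  have "0 < nat \<lfloor>?t\<rfloor>" by (rule le_less_trans[OF le0 x[OF n_pos]])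
  then have "1 \<le> \<lfloor>?t\<rfloor>" by simp
  then have t1: "1 \<le> ?t" by linarith
  have xt: "real (x ! i) < ?t" if "i < n" for i using x[OF that] by linarith
  have "T \<noteq> 0" using t1 by (auto simp: box_size_def)
  with T have Tpos: "0 < T" by simp
  have factor: "max 1 (\<tau> (combination x)) < M \<tau> * (n * ?t)" if \<tau>: "\<tau> \<in> ?R" for \<tau>
  proof -
    have "\<tau> (combination x) \<le> (\<Sum>i<n. M \<tau> * real (x ! i))"
      unfolding embedding_combination[OF \<tau>]
    proof (rule sum_mono)
      fix i assume "i \<in> {..<n}"
      then have "\<alpha> ! i \<in> set \<alpha>" by (simp add: n_def)
      then have "\<tau> (\<alpha> ! i) \<le> M \<tau>" using le_M[of "\<alpha> ! i" \<tau>] by simp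
      then show "\<tau> (\<alpha> ! i) * real (x ! i) \<le> M \<tau> * real (x ! i)" by (rule mult_right_mono) simp
    qed
    also have "\<dots> < (\<Sum>i<n. M \<tau> * ?t)"
    proof (rule sum_strict_mono)
      fix i assume "i \<in> {..<n}"
      then show "M \<tau> * real (x ! i) < M \<tau> * ?t"
        using xt M_ge_1[of \<tau>] by (intro mult_strict_left_mono) auto
    qed (use n_pos in auto)
    also have "\<dots> = M \<tau> * (n * ?t)" by simp
    finally have lt: "\<tau> (combination x) < M \<tau> * (n * ?t)" .
    \<comment> \<open>The alternative 1 in the maximum is where \<open>n > d \<ge> 1\<close> enters.\<close>
    have "1 < real n" using n_gt d_pos by simp
    also have "real n = 1 * (real n * 1)" by simp
    also have "\<dots> \<le> M \<tau> * (n * ?t)" using t1 M_ge_1[of \<tau>] by (intro mult_mono) auto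
    finally show ?thesis using lt by simp
  qed
  have pos: "0 < max 1 y" for y :: real by simp
  have "?R \<noteq> {}"
  proof
    assume empty: "?R = {}"
    have "d = 0" using card_embeddings unfolding empty by simp
    then show False using d_pos by simp
  qed
  then obtain \<tau>\<^sub>0 where "\<tau>\<^sub>0 \<in> ?R" by blast
  then have "(\<Prod>\<tau>\<in>?R. max 1 (\<tau> (combination x))) < (\<Prod>\<tau>\<in>?R. M \<tau> * (n * ?t))"
  proof (rule prod_mono_strict)
    show "max 1 (\<tau>\<^sub>0 (combination x)) < M \<tau>\<^sub>0 * (n * ?t)" by (rule factor[OF \<open>\<tau>\<^sub>0 \<in> ?R\<close>])
    fix \<tau> assume \<tau>: "\<tau> \<in> ?R"
    show "0 \<le> max 1 (\<tau> (combination x)) \<and> max 1 (\<tau> (combination x)) \<le> M \<tau> * (n * ?t)"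
      using pos[of "\<tau> (combination x)"] factor[OF \<tau>] by linarith
    show "0 < M \<tau> * (n * ?t)"
      using pos[of "\<tau> (combination x)"] factor[OF \<tau>] by linarith
  qed (rule fin)
  also have "\<dots> = height \<alpha> * (n * ?t) ^ d"
    by (simp add: prod.distrib height_\<alpha> card_embeddings)
  also have "\<dots> = T"
  proof -
    have root: "(y powr (1 / d)) ^ d = y" if "0 < y" for y :: real
      using that d_pos by (simp add: powr_realpow[symmetric] powr_powr)
    have "n * ?t = T powr (1 / d) / height \<alpha> powr (1 / d)" using n_pos by (simp add: box_size_def)
    then have "(n * ?t) ^ d = T / height \<alpha>"
      by (simp only: power_divide root[OF Tpos] root[OF height_\<alpha>_pos])
    then show ?thesis using height_\<alpha>_pos by simp
  qed
  finally show ?thesis unfolding height_combination .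
qed

definition solutions :: "real \<Rightarrow> real \<Rightarrow> nat list set" where
  "solutions T1 T2 = {x. length x = n \<and> T1 \<le> height [combination x] \<and> height [combination x] \<le> T2}"

lemma entries_le:
  assumes "height [combination x] \<le> T" "i < n"
  shows "x ! i < nat (\<lfloor>T\<rfloor> + 1)"
proof -
  have "real (x ! i) \<le> T" using entry_le_height[OF assms(2), of x] assms(1) by simp
  then have "int (x ! i) \<le> \<lfloor>T\<rfloor>" by (simp add: le_floor_iff)
  then show ?thesis by simp
qed

lemma finite_solutions: "finite (solutions T1 T2)"
  by (rule finite_subset[OF _ finite_bounded_lists[of n "nat (\<lfloor>T2\<rfloor> + 1)"]])
     (auto simp: solutions_def intro: entries_le)

lemma representations_eq: "representations \<alpha> \<beta> = {x. length x = n \<and> combination x = \<beta>}"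
  by (simp add: representations_def n_def combination_def)

lemma finite_representations: "finite (representations \<alpha> \<beta>)"
  by (rule finite_subset[OF _ finite_solutions[of 1 "height [\<beta>]"]])
     (use height_combination_ge_1 in \<open>auto simp: representations_eq solutions_def\<close>)

lemma mem_Sg_iff: "\<beta> \<in> Sg \<alpha> \<longleftrightarrow> representations \<alpha> \<beta> \<noteq> {}"
  by (auto simp: Sg_def representations_def)

lemma mem_Sg_s_iff:
  assumes "1 \<le> s"
  shows "\<beta> \<in> Sg_s s \<alpha> \<longleftrightarrow> s \<le> card (representations \<alpha> \<beta>)"
proof
  assume "\<beta> \<in> Sg_s s \<alpha>"
  then show "s \<le> card (representations \<alpha> \<beta>)"
    by (auto simp: Sg_s_def intro: card_mono[OF finite_representations])
next
  assume le: "s \<le> card (representations \<alpha> \<beta>)"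
  then obtain X where "X \<subseteq> representations \<alpha> \<beta>" "card X = s" "finite X"
    by (rule obtain_subset_with_card_n)
  moreover have "representations \<alpha> \<beta> \<noteq> {}" using le assms by auto
  ultimately show "\<beta> \<in> Sg_s s \<alpha>" by (auto simp: Sg_s_def mem_Sg_iff)
qed

lemma multiplicities: "{s. 1 \<le> s \<and> \<beta> \<in> Sg_s s \<alpha>} = {1..card (representations \<alpha> \<beta>)}"
  using mem_Sg_s_iff by auto

lemma rep_count_eq:
  assumes "\<beta> \<in> Sg \<alpha>"
  shows "rep_count \<alpha> \<beta> = card (representations \<alpha> \<beta>)"
proof -
  have "card (representations \<alpha> \<beta>) \<ge> 1"
    using assms finite_representations by (simp add: mem_Sg_iff Suc_le_eq card_gt_0_iff)
  then show ?thesis unfolding rep_count_def multiplicities by (intro Max_eqI) auto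
qed

lemma Sg_bounded_eq:
  assumes "1 \<le> s"
  shows "Sg_bounded s \<alpha> T1 T2 = {\<beta> \<in> combination ` solutions T1 T2. s \<le> card (representations \<alpha> \<beta>)}"
proof -
  have "\<beta> \<in> combination ` solutions T1 T2" if "s \<le> card (representations \<alpha> \<beta>)" "T1 \<le> height [\<beta>]" "height [\<beta>] \<le> T2" for \<beta>
  proof -
    have "representations \<alpha> \<beta> \<noteq> {}" using that(1) assms by auto
    then show ?thesis using that by (auto simp: representations_eq solutions_def)
  qed
  then show ?thesis by (auto simp: Sg_bounded_def mem_Sg_s_iff[OF assms] solutions_def)
qed

lemma finite_Sg_bounded: "1 \<le> s \<Longrightarrow> finite (Sg_bounded s \<alpha> T1 T2)"
  unfolding Sg_bounded_eq using finite_solutions by simp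

text \<open>
  The solution vectors are partitioned by the elements that they represent.
\<close>

lemma sum_rep_count: "(\<Sum>\<beta>\<in>Sg_bounded 1 \<alpha> T1 T2. real (rep_count \<alpha> \<beta>)) = card (solutions T1 T2)"
proof -
  let ?S = "Sg_bounded 1 \<alpha> T1 T2"
  have "solutions T1 T2 = (\<Union>\<beta>\<in>?S. representations \<alpha> \<beta>)"
  proof (intro equalityI subsetI)
    fix x assume x: "x \<in> solutions T1 T2"
    then have "x \<in> representations \<alpha> (combination x)" by (simp add: representations_eq solutions_def)
    moreover from this have "1 \<le> card (representations \<alpha> (combination x))"
      using finite_representations by (auto simp: Suc_le_eq card_gt_0_iff)
    ultimately show "x \<in> (\<Union>\<beta>\<in>?S. representations \<alpha> \<beta>)"
      using x by (auto simp: Sg_bounded_eq)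
  next
    fix x assume "x \<in> (\<Union>\<beta>\<in>?S. representations \<alpha> \<beta>)"
    then show "x \<in> solutions T1 T2"
      by (auto simp: Sg_bounded_def representations_eq solutions_def)
  qed
  also have "card \<dots> = (\<Sum>\<beta>\<in>?S. card (representations \<alpha> \<beta>))"
    by (rule card_UN_disjoint)
       (auto simp: finite_Sg_bounded finite_representations, auto simp: representations_eq)
  also have "\<dots> = (\<Sum>\<beta>\<in>?S. rep_count \<alpha> \<beta>)"
    by (rule sum.cong) (auto simp: Sg_bounded_def Sg_s_def rep_count_eq)
  finally show ?thesis by simp
qed

definition box :: "real \<Rightarrow> nat list set" where
  "box T = {x. length x = n \<and> (\<forall>i<n. x ! i < nat \<lfloor>box_size T\<rfloor>)}"

lemma card_box: "real (card (box T)) = of_int \<lfloor>box_size T\<rfloor> ^ n"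
  using box_size_nonneg[of T] by (simp add: box_def card_bounded_lists)

lemma height_lt_if_mem_box: "0 \<le> T \<Longrightarrow> x \<in> box T \<Longrightarrow> height [combination x] < T"
  using height_box by (auto simp: box_def)

definition c where "c = fact d * height \<alpha> / sqrt (cmod (discriminant TYPE('k)))"

lemma c_ge_1: "1 \<le> c"
proof -
  let ?M = "\<lambda>\<sigma> :: 'k \<Rightarrow> complex. Max (insert 1 ((\<lambda>a. cmod (\<sigma> a)) ` set \<alpha>))"
  have "(\<Prod>\<sigma>\<in>{\<sigma>. field_hom \<sigma>}. ?M \<sigma>) = (\<Prod>\<tau>\<in>real_embeddings. ?M (\<lambda>x. complex_of_real (\<tau> x)))"
    by (rule prod.reindex_bij_betw[OF real_embeddings_card(1)[OF nf tr], symmetric])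
  also have "\<dots> = height \<alpha>" by (simp add: height_\<alpha> M_def)
  finally have H: "(\<Prod>\<sigma>\<in>{\<sigma>. field_hom \<sigma>}. ?M \<sigma>) = height \<alpha>" .
  have M: "cmod (\<sigma> a) \<le> ?M \<sigma>" if "a \<in> set \<alpha>" for \<sigma> a using that by (intro Max_ge) auto
  have pos: "0 < sqrt (cmod (discriminant TYPE('k)))"
    by (rule discriminant_bound(1)[OF nf finite_set span d_def, of ?M]) (rule M)
  have "sqrt (cmod (discriminant TYPE('k))) \<le> fact d * (\<Prod>\<sigma>\<in>{\<sigma>. field_hom \<sigma>}. ?M \<sigma>)"
    by (rule discriminant_bound(2)[OF nf finite_set span d_def, of ?M]) (rule M)
  then have "sqrt (cmod (discriminant TYPE('k))) \<le> fact d * height \<alpha>" by (simp only: H)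
  with pos show ?thesis unfolding c_def by (simp only: le_divide_eq_1_pos)
qed

text \<open>
  Solutions of height at least \<open>T1\<close> and the box of \<open>T1\<close> are disjoint, and both lie in the cube of
  side \<open>T2 \<le> c * T2\<close>.
\<close>

lemma card_solutions_le:
  assumes "0 \<le> T1" "T1 < T2"
  shows "real (card (solutions T1 T2)) \<le> (c * T2 + 1) ^ n - of_int \<lfloor>box_size T1\<rfloor> ^ n"
proof -
  have "0 < T2" using assms by simp
  then have le: "T2 \<le> c * T2" using c_ge_1 by simp
  let ?m = "nat (\<lfloor>c * T2\<rfloor> + 1)"
  let ?L = "{x :: nat list. length x = n \<and> (\<forall>i<n. x ! i < ?m)}"
  have "height [combination x] \<le> c * T2" if "x \<in> solutions T1 T2 \<union> box T1" for x
  proof (rule order_trans[OF _ le])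
    show "height [combination x] \<le> T2"
      using that height_lt_if_mem_box[OF assms(1), of x] assms(2) by (auto simp: solutions_def)
  qed
  then have "solutions T1 T2 \<union> box T1 \<subseteq> ?L"
    by (auto simp: solutions_def box_def intro!: entries_le)
  then have "card (solutions T1 T2 \<union> box T1) \<le> ?m ^ n"
    using card_mono[OF finite_bounded_lists] by (simp only: card_bounded_lists)
  moreover have "card (solutions T1 T2 \<union> box T1) = card (solutions T1 T2) + card (box T1)"
  proof (rule card_Un_disjoint[OF finite_solutions])
    show "finite (box T1)" unfolding box_def by (rule finite_bounded_lists)
    show "solutions T1 T2 \<inter> box T1 = {}"
    proof (intro equalityI subsetI)
      fix x assume "x \<in> solutions T1 T2 \<inter> box T1"
      then have "T1 \<le> height [combination x]" "height [combination x] < T1"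
        using height_lt_if_mem_box[OF assms(1), of x] by (simp_all add: solutions_def)
      then show "x \<in> {}" by simp
    qed simp
  qed
  ultimately have "card (solutions T1 T2) + card (box T1) \<le> ?m ^ n" by simp
  then have "real (card (solutions T1 T2) + card (box T1)) \<le> real (?m ^ n)"
    by (simp only: of_nat_le_iff)
  then have "real (card (solutions T1 T2)) + real (card (box T1)) \<le> real ?m ^ n"
    by (simp only: of_nat_add of_nat_power)
  also have "\<dots> \<le> (c * T2 + 1) ^ n"
    using le \<open>0 < T2\<close> by (intro power_mono) (auto simp: of_nat_nat)
  finally show ?thesis by (simp add: card_box)
qed

text \<open>
  Every combination has height at least 1, so the whole box consists of solutions.
\<close>

lemma card_solutions_ge:
  assumes "1 \<le> T"
  shows "of_int \<lfloor>box_size T\<rfloor> ^ n \<le> real (card (solutions 1 T))"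
proof -
  have "box T \<subseteq> solutions 1 T"
  proof
    fix x assume x: "x \<in> box T"
    have "height [combination x] < T" using assms by (intro height_lt_if_mem_box x) simp
    with x show "x \<in> solutions 1 T" using height_combination_ge_1[of x] by (simp add: solutions_def box_def)
  qed
  then have "card (box T) \<le> card (solutions 1 T)" by (intro card_mono finite_solutions)
  then show ?thesis by (simp flip: card_box)
qed

end

theorem theorem1p3:
  fixes \<alpha> :: "'k::field_char_0 list" and d n :: nat and T1 T2 :: real
  assumes "number_field TYPE('k)" and "totally_real TYPE('k)"
    and "d = field_degree TYPE('k)"
    and "n > d" and "length \<alpha> = n"
    and "\<forall>a\<in>set \<alpha>. a \<noteq> 0 \<and> a \<in> nonneg_integers"
    and "ring_of_integers = module.span int_scale (set \<alpha>)"
    and "0 \<le> T1" and "T1 < T2"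
  defines "U \<equiv> (fact d * height \<alpha> / sqrt (cmod (discriminant TYPE('k))) * T2 + 1) ^ n
                 - of_int \<lfloor>T1 powr (1 / d) / (n * height \<alpha> powr (1 / d))\<rfloor> ^ n"
  shows "(\<forall>\<beta>\<in>Sg \<alpha>. finite {s. 1 \<le> s \<and> \<beta> \<in> Sg_s s \<alpha>})
    \<and> finite (Sg_bounded 1 \<alpha> T1 T2)
    \<and> (\<Sum>\<beta>\<in>Sg_bounded 1 \<alpha> T1 T2. real (rep_count \<alpha> \<beta>)) \<le> U
    \<and> (\<forall>s\<ge>1. finite (Sg_bounded s \<alpha> T1 T2)
           \<and> real (card (Sg_bounded s \<alpha> T1 T2)) \<le> 1 / real s * U)
    \<and> (\<forall>T\<ge>1. finite (Sg_bounded 1 \<alpha> 1 T)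
           \<and> (\<Sum>\<beta>\<in>Sg_bounded 1 \<alpha> 1 T. real (rep_count \<alpha> \<beta>))
               \<ge> of_int \<lfloor>T powr (1 / d) / (n * height \<alpha> powr (1 / d))\<rfloor> ^ n)"
proof -
  interpret G: totally_real_generators \<alpha>
    using assms by unfold_locales auto
  have dn: "G.d = d" "G.n = n" using assms by (simp_all add: G.d_def G.n_def)
  have U: "U = (G.c * T2 + 1) ^ n - of_int \<lfloor>G.box_size T1\<rfloor> ^ n"
    by (simp only: U_def G.c_def G.box_size_def dn)
  have total: "(\<Sum>\<beta>\<in>Sg_bounded 1 \<alpha> T1 T2. real (rep_count \<alpha> \<beta>)) \<le> U"
    unfolding G.sum_rep_count U using G.card_solutions_le[OF assms(8,9)] by (simp only: dn)
  have card: "real (card (Sg_bounded s \<alpha> T1 T2)) \<le> 1 / real s * U" if s: "1 \<le> s" for s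
  proof -
    let ?S = "Sg_bounded s \<alpha> T1 T2"
    have sub: "?S \<subseteq> Sg_bounded 1 \<alpha> T1 T2" using s by (auto simp: G.Sg_bounded_eq)
    have "real s * real (card ?S) = (\<Sum>\<beta>\<in>?S. real s)" by simp
    also have "\<dots> \<le> (\<Sum>\<beta>\<in>?S. real (rep_count \<alpha> \<beta>))"
    proof (rule sum_mono)
      fix \<beta> assume \<beta>: "\<beta> \<in> ?S"
      then have "\<beta> \<in> Sg \<alpha>" by (simp add: Sg_bounded_def Sg_s_def)
      with \<beta> show "real s \<le> real (rep_count \<alpha> \<beta>)"
        using s by (simp add: G.rep_count_eq G.Sg_bounded_eq)
    qed
    also have "\<dots> \<le> (\<Sum>\<beta>\<in>Sg_bounded 1 \<alpha> T1 T2. real (rep_count \<alpha> \<beta>))"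
      by (rule sum_mono2[OF G.finite_Sg_bounded[OF order.refl] sub]) simp
    also note total
    finally show ?thesis using s by (simp add: field_simps)
  qed
  have lower: "of_int \<lfloor>T powr (1 / d) / (n * height \<alpha> powr (1 / d))\<rfloor> ^ n
      \<le> (\<Sum>\<beta>\<in>Sg_bounded 1 \<alpha> 1 T. real (rep_count \<alpha> \<beta>))" if "1 \<le> T" for T
    using G.card_solutions_ge[OF that] unfolding G.sum_rep_count by (simp only: G.box_size_def dn)
  have "finite {s. 1 \<le> s \<and> \<beta> \<in> Sg_s s \<alpha>}" for \<beta>
    unfolding G.multiplicities by simp
  then show ?thesis
    by (intro conjI ballI allI impI total card lower G.finite_Sg_bounded order.refl)
qed


end
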